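(* Fix $(t,x)\in[0,T]\times\mathbb R^N$. The condition $$\frac1{\gamma^i}\frac{\partial^2 H_v^i}{\partial u^j\partial u^i}(t,x,u)=\frac1{\gamma^j}\frac{\partial^2 H_v^j}{\partial u^i\partial u^j}(t,x,u),\qquad i\ne j,$$ holds if and only if, on a simply connected action domain, there is a scalar function $\Phi_v$ such that $$\partial_{u^i}\Phi_v(t,x,u)=\frac1{\gamma^i}\partial_{u^i}H_v^i(t,x,u),\qquad i=1,\ldots,N.$$ If $\gamma^1=\cdots=\gamma^N=\gamma$ and the time-slice Hamiltonian game (the game with payoffs $u\mapsto H^i_v(t,x,u)$, $i=1,\dots,N$) is an exact potential game with potential $P_v$, then $\Phi_v=P_v/\gamma$ and the compatible joint law is the Gibbs density $\psi^v\propto e^{P_v/\gamma}$.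
   Context: Setting. $N\in\mathbb N$ is the number of players, $T>0$ the horizon, $U\subset\mathbb R$ the (scalar) action set. For $u=(u^1,\dots,u^N)\in U^N$, $u^{-i}\in U^{N-1}$ is $u$ with coordinate $u^i$ deleted, and $(u^i,u^{-i})$ stands for $u$. The action domain is the interior of $U^N$, taken to be connected and simply connected, and the functions $H_v^i(t,x,\cdot)$ below are twice continuously differentiable there. Data: measurable $b^k,\sigma^k:[0,T]\times\mathbb R^N\times U^N\to\mathbb R$, running rewards $f^i:[0,T]\times\mathbb R^N\times U\to\mathbb R$, terminal rewards $g^i:\mathbb R^N\to\mathbb R$, discount rates $\beta^i\ge0$, exploration weights $\gamma^i>0$. Hamiltonian: for $p\in\mathbb R^N$ and a symmetric matrix $A$, $$H^i(t,x,u,p,A)=\sum_{k=1}^N\big[b^k(t,x,u)p^k+\tfrac12\sigma^k(t,x,u)^2A^{k,k}\big]+f^i(t,x,u^i).$$ Continuation assessment: for fixed $u^{-i}\in U^{N-1}$, let $v^i(t,x;u^{-i})=\tilde V^i(t,x;u^{-i})$ be the value function of player $i$'s entropy-regularized single-agent control problem in which the opponents' actions are frozen at $u^{-i}$ on the whole remaining horizon. It is a classical ($C^{1,2}$ in $(t,x)$) solution of $$0=\partial_t\tilde V^i-\beta^i\tilde V^i+\gamma^i\log\int_U\exp\Big\{\tfrac1{\gamma^i}H^i(t,x,u^i,u^{-i},\partial_x\tilde V^i,\partial_x^2\tilde V^i)\Big\}du^i,\qquad \tilde V^i(T,x;u^{-i})=g^i(x).$$ Local Hamiltonian: $H_v^i(t,x,u):=H^i\big(t,x,u,\partial_xv^i(t,x;u^{-i}),\partial_x^2v^i(t,x;u^{-i})\big)$.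 Time-local conditional response of player $i$: $$\pi^{i,v}_*(u^i;t,x,u^{-i}):=\frac{\exp\{H_v^i(t,x,u^i,u^{-i})/\gamma^i\}}{\int_U\exp\{H_v^i(t,x,z^i,u^{-i})/\gamma^i\}\,dz^i}$$ (defined when the denominator is finite). Compatible joint law (time-local conditional equilibrium) at $(t,x)$: a positive joint probability density $\psi^v(\cdot;t,x)$ on $U^N$ whose full conditional densities satisfy, for every $i$, $\psi^v(u^i\mid u^{-i};t,x)=\pi^{i,v}_*(u^i;t,x,u^{-i})$ for a.e. $u^{-i}$. Exact potential game with potential $P_v$: for every $i$, every $u^{-i}$ and all $u^i,z^i\in U$, $H_v^i(t,x,u^i,u^{-i})-H_v^i(t,x,z^i,u^{-i})=P_v(u^i,u^{-i})-P_v(z^i,u^{-i})$. *)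

theory Defs
  imports "HOL-Analysis.Analysis"
begin

text \<open>
  Players are the elements of a finite type, so that there are \<open>CARD('n)\<close> of them.  An action profile
  of all players is a vector \<open>u :: real ^ 'n\<close>; an action profile of the opponents of player \<open>i\<close> is a
  function \<open>w\<close> that is extensional on \<open>UNIV - {i}\<close>, i.e. a point of the product measure space
  \<open>PiM (UNIV - {i})\<close>.
\<close>

definition profiles :: "real set \<Rightarrow> (real ^ 'n) set" where
  "profiles U = {u. \<forall>k. u $ k \<in> U}"

definition opponent_profiles :: "real set \<Rightarrow> 'n \<Rightarrow> ('n \<Rightarrow> real) set" where
  "opponent_profiles U i = (\<Pi>\<^sub>E k\<in>UNIV - {i}. U)"

definition others :: "'n \<Rightarrow> real ^ 'n \<Rightarrow> 'n \<Rightarrow> real" where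
  "others i u = restrict (\<lambda>k. u $ k) (UNIV - {i})"

definition join :: "'n \<Rightarrow> real \<Rightarrow> ('n \<Rightarrow> real) \<Rightarrow> real ^ 'n" where
  "join i a w = (\<chi> k. if k = i then a else w k)"

definition pd :: "'n \<Rightarrow> (real ^ 'n \<Rightarrow> real) \<Rightarrow> real ^ 'n \<Rightarrow> real" where
  "pd i f u = deriv (\<lambda>h. f (u + h *\<^sub>R axis i 1)) 0"

definition grad :: "(real ^ 'n \<Rightarrow> real) \<Rightarrow> real ^ 'n \<Rightarrow> real ^ 'n" where
  "grad f x = (\<chi> k. pd k f x)"

definition hessian :: "(real ^ 'n \<Rightarrow> real) \<Rightarrow> real ^ 'n \<Rightarrow> real ^ 'n ^ 'n" where
  "hessian f x = (\<chi> k l. pd k (pd l f) x)"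

definition C1_on :: "(real ^ 'n) set \<Rightarrow> (real ^ 'n \<Rightarrow> real) \<Rightarrow> bool" where
  "C1_on D f \<longleftrightarrow> (\<forall>u\<in>D. f differentiable (at u)) \<and> (\<forall>i. continuous_on D (pd i f))"

definition C2_on :: "(real ^ 'n) set \<Rightarrow> (real ^ 'n \<Rightarrow> real) \<Rightarrow> bool" where
  "C2_on D f \<longleftrightarrow> C1_on D f \<and> (\<forall>i. C1_on D (pd i f))"

text \<open>One-sided time derivatives are used at the end points of \<open>[0, T]\<close>.\<close>

definition dt :: "real \<Rightarrow> (real \<Rightarrow> real ^ 'n \<Rightarrow> real) \<Rightarrow> real \<Rightarrow> real ^ 'n \<Rightarrow> real" where
  "dt T V t x = vector_derivative (\<lambda>s. V s x) (at t within {0..T})"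

definition C12 :: "real \<Rightarrow> (real \<Rightarrow> real ^ 'n \<Rightarrow> real) \<Rightarrow> bool" where
  "C12 T V \<longleftrightarrow>
     (\<forall>t\<in>{0..T}. \<forall>x. (\<lambda>s. V s x) differentiable (at t within {0..T})) \<and>
     (\<forall>t\<in>{0..T}. C2_on UNIV (V t)) \<and>
     continuous_on ({0..T} \<times> UNIV) (\<lambda>(t, x). V t x) \<and>
     continuous_on ({0..T} \<times> UNIV) (\<lambda>(t, x). dt T V t x) \<and>
     continuous_on ({0..T} \<times> UNIV) (\<lambda>(t, x). grad (V t) x) \<and>
     continuous_on ({0..T} \<times> UNIV) (\<lambda>(t, x). hessian (V t) x)"

definition hamiltonian ::
  "('n \<Rightarrow> real \<Rightarrow> real ^ 'n \<Rightarrow> real ^ 'n \<Rightarrow> real) \<Rightarrow> ('n \<Rightarrow> real \<Rightarrow> real ^ 'n \<Rightarrow> real ^ 'n \<Rightarrow> real) \<Rightarrow>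
   ('n \<Rightarrow> real \<Rightarrow> real ^ 'n \<Rightarrow> real \<Rightarrow> real) \<Rightarrow>
   'n \<Rightarrow> real \<Rightarrow> real ^ 'n \<Rightarrow> real ^ 'n \<Rightarrow> real ^ 'n \<Rightarrow> real ^ 'n ^ 'n \<Rightarrow> real" where
  "hamiltonian b \<sigma> f i t x u p A =
     (\<Sum>k\<in>UNIV. b k t x u * p $ k + 1 / 2 * (\<sigma> k t x u)\<^sup>2 * A $ k $ k) + f i t x (u $ i)"

text \<open>
  \<open>V\<close> is a classical solution of the exploratory HJB equation of player \<open>i\<close> when the opponents'
  actions are frozen at \<open>w\<close>.  The integrability clause makes the Bochner integral in the equation
  the genuine one.
\<close>

definition classical_solution ::
  "('n \<Rightarrow> real \<Rightarrow> real ^ 'n \<Rightarrow> real ^ 'n \<Rightarrow> real) \<Rightarrow> ('n \<Rightarrow> real \<Rightarrow> real ^ 'n \<Rightarrow> real ^ 'n \<Rightarrow> real) \<Rightarrow>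
   ('n \<Rightarrow> real \<Rightarrow> real ^ 'n \<Rightarrow> real \<Rightarrow> real) \<Rightarrow> ('n \<Rightarrow> real ^ 'n \<Rightarrow> real) \<Rightarrow>
   ('n \<Rightarrow> real) \<Rightarrow> ('n \<Rightarrow> real) \<Rightarrow> real \<Rightarrow> real set \<Rightarrow>
   'n \<Rightarrow> ('n \<Rightarrow> real) \<Rightarrow> (real \<Rightarrow> real ^ 'n \<Rightarrow> real) \<Rightarrow> bool" where
  "classical_solution b \<sigma> f g \<beta> \<gamma> T U i w V \<longleftrightarrow>
     C12 T V \<and>
     (\<forall>t\<in>{0..<T}. \<forall>x.
        let E = (\<lambda>a. exp (1 / \<gamma> i * hamiltonian b \<sigma> f i t x (join i a w) (grad (V t) x) (hessian (V t) x)))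
        in set_integrable lborel U E \<and>
           0 = dt T V t x - \<beta> i * V t x + \<gamma> i * ln (set_lebesgue_integral lborel U E)) \<and>
     (\<forall>x. V T x = g i x)"

text \<open>In \<open>v i t x w\<close>, \<open>w\<close> is the frozen profile of the opponents of player \<open>i\<close>.\<close>

definition local_hamiltonian ::
  "('n \<Rightarrow> real \<Rightarrow> real ^ 'n \<Rightarrow> real ^ 'n \<Rightarrow> real) \<Rightarrow> ('n \<Rightarrow> real \<Rightarrow> real ^ 'n \<Rightarrow> real ^ 'n \<Rightarrow> real) \<Rightarrow>
   ('n \<Rightarrow> real \<Rightarrow> real ^ 'n \<Rightarrow> real \<Rightarrow> real) \<Rightarrow>
   ('n \<Rightarrow> real \<Rightarrow> real ^ 'n \<Rightarrow> ('n \<Rightarrow> real) \<Rightarrow> real) \<Rightarrow>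
   'n \<Rightarrow> real \<Rightarrow> real ^ 'n \<Rightarrow> real ^ 'n \<Rightarrow> real" where
  "local_hamiltonian b \<sigma> f v i t x u =
     hamiltonian b \<sigma> f i t x u
       (grad (\<lambda>y. v i t y (others i u)) x) (hessian (\<lambda>y. v i t y (others i u)) x)"

text \<open>
  The remaining notions concern one time slice: \<open>H i u\<close> is the payoff of player \<open>i\<close> at the profile
  \<open>u\<close>, in the application the local Hamiltonian at a fixed \<open>(t, x)\<close>.
\<close>

definition response_defined ::
  "('n \<Rightarrow> real ^ 'n \<Rightarrow> real) \<Rightarrow> ('n \<Rightarrow> real) \<Rightarrow> real set \<Rightarrow> 'n \<Rightarrow> ('n \<Rightarrow> real) \<Rightarrow> bool" where
  "response_defined H \<gamma> U i w \<longleftrightarrow> set_integrable lborel U (\<lambda>z. exp (H i (join i z w) / \<gamma> i))"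

definition conditional_response ::
  "('n \<Rightarrow> real ^ 'n \<Rightarrow> real) \<Rightarrow> ('n \<Rightarrow> real) \<Rightarrow> real set \<Rightarrow> 'n \<Rightarrow> real \<Rightarrow> ('n \<Rightarrow> real) \<Rightarrow> real" where
  "conditional_response H \<gamma> U i a w =
     exp (H i (join i a w) / \<gamma> i) / set_lebesgue_integral lborel U (\<lambda>z. exp (H i (join i z w) / \<gamma> i))"

definition positive_density :: "real set \<Rightarrow> (real ^ 'n \<Rightarrow> real) \<Rightarrow> bool" where
  "positive_density U \<psi> \<longleftrightarrow>
     (\<forall>u\<in>profiles U. 0 < \<psi> u) \<and> set_integrable lborel (profiles U) \<psi> \<and>
     set_lebesgue_integral lborel (profiles U) \<psi> = 1"

definition full_conditional ::
  "real set \<Rightarrow> (real ^ 'n \<Rightarrow> real) \<Rightarrow> 'n \<Rightarrow> real \<Rightarrow> ('n \<Rightarrow> real) \<Rightarrow> real" where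
  "full_conditional U \<psi> i a w =
     \<psi> (join i a w) / set_lebesgue_integral lborel U (\<lambda>z. \<psi> (join i z w))"

text \<open>Conditional densities are compared as densities, i.e. up to null sets of own actions \<open>a\<close>.\<close>

definition compatible_joint_law ::
  "('n \<Rightarrow> real ^ 'n \<Rightarrow> real) \<Rightarrow> ('n \<Rightarrow> real) \<Rightarrow> real set \<Rightarrow> (real ^ 'n \<Rightarrow> real) \<Rightarrow> bool" where
  "compatible_joint_law H \<gamma> U \<psi> \<longleftrightarrow>
     positive_density U \<psi> \<and>
     (\<forall>i. AE w in PiM (UNIV - {i}) (\<lambda>_. lborel). w \<in> opponent_profiles U i \<longrightarrow>
        response_defined H \<gamma> U i w \<and>
        (AE a in lborel. a \<in> U \<longrightarrow> full_conditional U \<psi> i a w = conditional_response H \<gamma> U i a w))"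

definition exact_potential ::
  "('n \<Rightarrow> real ^ 'n \<Rightarrow> real) \<Rightarrow> real set \<Rightarrow> (real ^ 'n \<Rightarrow> real) \<Rightarrow> bool" where
  "exact_potential H U P \<longleftrightarrow>
     (\<forall>i. \<forall>w\<in>opponent_profiles U i. \<forall>a\<in>U. \<forall>z\<in>U.
        H i (join i a w) - H i (join i z w) = P (join i a w) - P (join i z w))"

text \<open>\<open>\<Phi>\<close> has the weighted own-action derivatives as its partial derivatives (which must exist).\<close>

definition response_potential ::
  "('n \<Rightarrow> real ^ 'n \<Rightarrow> real) \<Rightarrow> ('n \<Rightarrow> real) \<Rightarrow> (real ^ 'n) set \<Rightarrow> (real ^ 'n \<Rightarrow> real) \<Rightarrow> bool" where
  "response_potential H \<gamma> D \<Phi> \<longleftrightarrow>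
     (\<forall>u\<in>D. \<forall>i. ((\<lambda>h. \<Phi> (u + h *\<^sub>R axis i 1)) has_real_derivative 1 / \<gamma> i * pd i (H i) u) (at 0))"

definition gibbs_density :: "real set \<Rightarrow> (real ^ 'n \<Rightarrow> real) \<Rightarrow> real \<Rightarrow> real ^ 'n \<Rightarrow> real" where
  "gibbs_density U P c u =
     exp (P u / c) / set_lebesgue_integral lborel (profiles U) (\<lambda>z. exp (P z / c))"

end

theory Submission
  imports Defs
begin

text \<open>
  The interior of \<open>U ^ N\<close> is the \<open>N\<close>-th power of the interior of \<open>U\<close>; if it is connected, then
  the interior of \<open>U\<close> is an interval and the action domain is an open convex box.  There the cross
  condition says that the weighted own-action gradients form a closed field, so one direction is
  the Poincare lemma (integration along segments from a base point) and the other the symmetry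
  of mixed second derivatives.

  If \<open>P\<close> is an exact potential and all weights equal \<open>c\<close>, then \<open>exp (H i / c)\<close> and
  \<open>exp (P / c)\<close> are proportional on every line parallel to the \<open>i\<close>-th axis, so they have the same
  normalization, and the Gibbs density is compatible.  Conversely, for a compatible law \<open>\<psi>\<close> the
  quotient \<open>\<psi> / exp (P / c)\<close> is almost everywhere constant on almost every line parallel to any
  axis.  By Fubini's theorem a Borel function with this property is almost everywhere constant.
  For this \<open>P\<close> has to be Borel: it is a finite telescoping sum of differences of the \<open>H i\<close>, and these
  are Borel because the derivatives of the value functions are limits of difference quotients.
\<close>

section \<open>Partial derivatives\<close>

text \<open>Composing the Frechet derivative with the line along an axis shows that its value at
  \<open>axis k 1\<close> is the number \<open>pd k f u\<close>; expansion in the standard basis and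
  linearity give the rest.\<close>

lemma has_derivative_pd:
  fixes f :: "real ^ 'n::finite \<Rightarrow> real"
  assumes "f differentiable (at u)"
  shows "(f has_derivative (\<lambda>v. \<Sum>k\<in>UNIV. v $ k * pd k f u)) (at u)"
proof -
  from assms obtain f' where f': "(f has_derivative f') (at u)"
    by (auto simp: differentiable_def)
  then interpret f': bounded_linear f'
    by (rule has_derivative_bounded_linear)
  have pd: "pd k f u = f' (axis k 1)" for k
  proof -
    have "((\<lambda>h. f (u + h *\<^sub>R axis k 1)) has_derivative (\<lambda>h. f' (h *\<^sub>R axis k 1))) (at 0)"
      by (rule has_derivative_compose[where g = f and g' = f'])
        (use f' in \<open>auto intro!: derivative_eq_intros\<close>)
    then have "((\<lambda>h. f (u + h *\<^sub>R axis k 1)) has_real_derivative f' (axis k 1)) (at 0)"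
      by (simp add: has_field_derivative_def f'.scaleR mult.commute[of _ "f' (axis k 1)"])
    then show ?thesis
      unfolding pd_def by (rule DERIV_imp_deriv)
  qed
  have "f' v = (\<Sum>k\<in>UNIV. v $ k * pd k f u)" for v
    using f'.sum[of "\<lambda>k. v $ k *\<^sub>R axis k 1" UNIV] basis_expansion[of v]
    by (simp add: pd f'.scaleR scalar_mult_eq_scaleR)
  then have "f' = (\<lambda>v. \<Sum>k\<in>UNIV. v $ k * pd k f u)" ..
  with f' show ?thesis by simp
qed

lemma has_real_derivative_shift_axis:
  fixes f :: "real ^ 'n::finite \<Rightarrow> real"
  assumes "((\<lambda>h. f (u + s *\<^sub>R axis i 1 + h *\<^sub>R axis i 1)) has_real_derivative d) (at 0)"
  shows "((\<lambda>h. f (u + h *\<^sub>R axis i 1)) has_real_derivative d) (at s)"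
  using assms DERIV_shift[of "\<lambda>h. f (u + h *\<^sub>R axis i 1)" d 0 s]
  by (simp add: algebra_simps)

lemma has_real_derivative_pd:
  fixes f :: "real ^ 'n::finite \<Rightarrow> real"
  assumes "f differentiable (at (u + s *\<^sub>R axis i 1))"
  shows "((\<lambda>h. f (u + h *\<^sub>R axis i 1)) has_real_derivative pd i f (u + s *\<^sub>R axis i 1)) (at s)"
proof (rule has_real_derivative_shift_axis)
  let ?p = "u + s *\<^sub>R axis i 1"
  have "((\<lambda>h. f (?p + h *\<^sub>R axis i 1)) has_derivative
      (\<lambda>h. \<Sum>k\<in>UNIV. (h *\<^sub>R axis i 1 :: real ^ 'n) $ k * pd k f ?p)) (at 0)"
    by (rule has_derivative_compose[where g = f])
      (use has_derivative_pd[OF assms] in \<open>auto intro!: derivative_eq_intros\<close>)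
  moreover have "(h *\<^sub>R axis i 1 :: real ^ 'n) $ k * pd k f ?p = (if k = i then h * pd k f ?p else 0)" for h k
    by (simp add: axis_def)
  then have "(\<lambda>h. \<Sum>k\<in>UNIV. (h *\<^sub>R axis i 1 :: real ^ 'n) $ k * pd k f ?p) = (*) (pd i f ?p)"
    by (simp add: fun_eq_iff)
  ultimately show "((\<lambda>h. f (?p + h *\<^sub>R axis i 1)) has_real_derivative pd i f ?p) (at 0)"
    by (simp add: has_field_derivative_def)
qed

section \<open>Symmetry of second partial derivatives\<close>

lemma mvt_axis:
  fixes f :: "real ^ 'n::finite \<Rightarrow> real"
  assumes "0 < h"
    and "\<And>s. s \<in> {0..h} \<Longrightarrow>
      ((\<lambda>r. f (u + s *\<^sub>R axis i 1 + r *\<^sub>R axis i 1)) has_real_derivative f' (u + s *\<^sub>R axis i 1)) (at 0)"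
  shows "\<exists>s\<in>{0<..<h}. f (u + h *\<^sub>R axis i 1) - f u = h * f' (u + s *\<^sub>R axis i 1)"
proof -
  have "\<exists>s. 0 < s \<and> s < h \<and> f (u + h *\<^sub>R axis i 1) - f (u + 0 *\<^sub>R axis i 1) = (h - 0) * f' (u + s *\<^sub>R axis i 1)"
    by (rule MVT2[OF assms(1)], rule has_real_derivative_shift_axis, rule assms(2)) simp
  then show ?thesis by auto
qed

text \<open>The second difference over a square of side \<open>h\<close> is a difference in
  direction \<open>i\<close> of the function \<open>?q\<close>, itself a difference in direction
  \<open>j\<close>. The mean value theorem is applied first to \<open>?q\<close> along
  \<open>i\<close>, then to \<open>F\<close> along \<open>j\<close>.\<close>

lemma mixed_difference_mvt:
  fixes \<Phi> :: "real ^ 'n::finite \<Rightarrow> real"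
  assumes h: "0 < h"
    and sq: "\<And>s r. s \<in> {0..h} \<Longrightarrow> r \<in> {0..h} \<Longrightarrow> u + s *\<^sub>R axis i 1 + r *\<^sub>R axis j 1 \<in> D"
    and \<Phi>: "\<And>y. y \<in> D \<Longrightarrow> ((\<lambda>h. \<Phi> (y + h *\<^sub>R axis i 1)) has_real_derivative F y) (at 0)"
    and F: "\<And>y. y \<in> D \<Longrightarrow> F differentiable (at y)"
  shows "\<exists>s\<in>{0<..<h}. \<exists>r\<in>{0<..<h}.
    \<Phi> (u + h *\<^sub>R axis i 1 + h *\<^sub>R axis j 1) - \<Phi> (u + h *\<^sub>R axis i 1) - \<Phi> (u + h *\<^sub>R axis j 1) + \<Phi> u =
      h\<^sup>2 * pd j F (u + s *\<^sub>R axis i 1 + r *\<^sub>R axis j 1)"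
proof -
  let ?q = "\<lambda>y. \<Phi> (y + h *\<^sub>R axis j 1) - \<Phi> y"
  have "\<exists>s\<in>{0<..<h}. ?q (u + h *\<^sub>R axis i 1) - ?q u =
      h * (\<lambda>y. F (y + h *\<^sub>R axis j 1) - F y) (u + s *\<^sub>R axis i 1)"
  proof (rule mvt_axis[OF h])
    fix s assume s: "s \<in> {0..h}"
    have *: "u + s *\<^sub>R axis i 1 + h *\<^sub>R axis j 1 \<in> D" "u + s *\<^sub>R axis i 1 \<in> D"
      using sq[of s h] sq[of s 0] s h by auto
    show "((\<lambda>r. ?q (u + s *\<^sub>R axis i 1 + r *\<^sub>R axis i 1)) has_real_derivative
        F (u + s *\<^sub>R axis i 1 + h *\<^sub>R axis j 1) - F (u + s *\<^sub>R axis i 1)) (at 0)"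
      using DERIV_diff[OF \<Phi>[OF *(1)] \<Phi>[OF *(2)]] by (simp add: algebra_simps)
  qed
  then obtain s where s: "s \<in> {0<..<h}"
    and 1: "?q (u + h *\<^sub>R axis i 1) - ?q u =
      h * (F (u + s *\<^sub>R axis i 1 + h *\<^sub>R axis j 1) - F (u + s *\<^sub>R axis i 1))"
    by auto
  have "\<exists>r\<in>{0<..<h}. F (u + s *\<^sub>R axis i 1 + h *\<^sub>R axis j 1) - F (u + s *\<^sub>R axis i 1) =
      h * pd j F (u + s *\<^sub>R axis i 1 + r *\<^sub>R axis j 1)"
  proof (rule mvt_axis[OF h])
    fix r assume "r \<in> {0..h}"
    then have "F differentiable (at (u + s *\<^sub>R axis i 1 + r *\<^sub>R axis j 1 + 0 *\<^sub>R axis j 1))"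
      using s F sq by auto
    from has_real_derivative_pd[OF this]
    show "((\<lambda>ra. F (u + s *\<^sub>R axis i 1 + r *\<^sub>R axis j 1 + ra *\<^sub>R axis j 1)) has_real_derivative
        pd j F (u + s *\<^sub>R axis i 1 + r *\<^sub>R axis j 1)) (at 0)"
      by simp
  qed
  with 1 s show ?thesis
    by (force simp: power2_eq_square algebra_simps)
qed

text \<open>Schwarz's theorem for a function \<open>\<Phi>\<close> known only through its partial
  derivatives \<open>F\<close>. The second difference does not depend on the order of the
  directions, so after division by the square of \<open>h\<close> the two mixed derivatives agree at
  two points near \<open>u\<close>; continuity then forces agreement at \<open>u\<close>.\<close>

lemma pd_symmetric:
  fixes \<Phi> :: "real ^ 'n::finite \<Rightarrow> real"
  assumes D: "open D" "u \<in> D"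
    and \<Phi>: "\<And>y k. y \<in> D \<Longrightarrow> ((\<lambda>h. \<Phi> (y + h *\<^sub>R axis k 1)) has_real_derivative F k y) (at 0)"
    and F: "\<And>k. C1_on D (F k)"
  shows "pd j (F i) u = pd i (F j) u"
proof (rule ccontr)
  assume ne: "pd j (F i) u \<noteq> pd i (F j) u"
  \<comment> \<open>Half the gap: two numbers, each closer than \<open>e\<close> to its own mixed
    derivative at \<open>u\<close>, cannot coincide.\<close>
  define e where "e = \<bar>pd j (F i) u - pd i (F j) u\<bar> / 2"
  have e: "0 < e" using ne by (simp add: e_def)
  have cont: "isCont (pd j (F i)) u" "isCont (pd i (F j)) u"
    using F D by (auto simp: C1_on_def continuous_on_eq_continuous_at)
  from cont(1) e obtain d1 where d1: "0 < d1" "\<And>y. dist y u < d1 \<Longrightarrow> dist (pd j (F i) y) (pd j (F i) u) < e"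
    unfolding continuous_at_eps_delta by blast
  from cont(2) e obtain d2 where d2: "0 < d2" "\<And>y. dist y u < d2 \<Longrightarrow> dist (pd i (F j) y) (pd i (F j) u) < e"
    unfolding continuous_at_eps_delta by blast
  from D obtain d3 where d3: "0 < d3" "\<And>y. dist y u < d3 \<Longrightarrow> y \<in> D"
    by (auto simp: open_dist)
  \<comment> \<open>Points of the square of side \<open>h\<close> at \<open>u\<close> are within
    \<open>2 * h\<close> of \<open>u\<close>; a third of the smallest radius keeps that strictly
    below every radius.\<close>
  define h where "h = min d1 (min d2 d3) / 3"
  have h: "0 < h" "h * 2 < d1" "h * 2 < d2" "h * 2 < d3"
    using d1(1) d2(1) d3(1) by (auto simp: h_def min_def)
  have near: "dist (u + s *\<^sub>R axis k 1 + r *\<^sub>R axis l 1) u \<le> h * 2"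
    if "s \<in> {0..h}" "r \<in> {0..h}" for s r k l
  proof -
    have "norm (s *\<^sub>R axis k 1 + r *\<^sub>R axis l 1 :: real ^ 'n) \<le> \<bar>s\<bar> + \<bar>r\<bar>"
      by (rule norm_triangle_le) (simp add: norm_axis_1)
    then show ?thesis using that by (simp add: dist_norm algebra_simps)
  qed
  have diff: "F k differentiable (at y)" if "y \<in> D" for k y
    using F that by (auto simp: C1_on_def)
  have sq: "u + s *\<^sub>R axis k 1 + r *\<^sub>R axis l 1 \<in> D" if "s \<in> {0..h}" "r \<in> {0..h}" for s r k l
    using near[OF that] h(4) by (intro d3(2)) (rule le_less_trans)
  obtain s r where sr: "s \<in> {0<..<h}" "r \<in> {0<..<h}"
    "\<Phi> (u + h *\<^sub>R axis i 1 + h *\<^sub>R axis j 1) - \<Phi> (u + h *\<^sub>R axis i 1) - \<Phi> (u + h *\<^sub>R axis j 1) + \<Phi> u =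
      h\<^sup>2 * pd j (F i) (u + s *\<^sub>R axis i 1 + r *\<^sub>R axis j 1)"
    using mixed_difference_mvt[OF h(1) sq \<Phi> diff, of i j] by blast
  obtain s' r' where sr': "s' \<in> {0<..<h}" "r' \<in> {0<..<h}"
    "\<Phi> (u + h *\<^sub>R axis j 1 + h *\<^sub>R axis i 1) - \<Phi> (u + h *\<^sub>R axis j 1) - \<Phi> (u + h *\<^sub>R axis i 1) + \<Phi> u =
      h\<^sup>2 * pd i (F j) (u + s' *\<^sub>R axis j 1 + r' *\<^sub>R axis i 1)"
    using mixed_difference_mvt[OF h(1) sq \<Phi> diff, of j i] by blast
  let ?y = "u + s *\<^sub>R axis i 1 + r *\<^sub>R axis j 1" and ?y' = "u + s' *\<^sub>R axis j 1 + r' *\<^sub>R axis i 1"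
  have "u + h *\<^sub>R axis j 1 + h *\<^sub>R axis i 1 = u + h *\<^sub>R axis i 1 + h *\<^sub>R axis j 1"
    by (simp add: algebra_simps)
  with sr(3) sr'(3) have "h\<^sup>2 * pd j (F i) ?y = h\<^sup>2 * pd i (F j) ?y'"
    by (simp add: algebra_simps)
  with h(1) have eq: "pd j (F i) ?y = pd i (F j) ?y'" by simp
  have "dist ?y u < d1" "dist ?y' u < d2"
    using near[of s r i j] near[of s' r' j i] sr(1,2) sr'(1,2) h by auto
  from d1(2)[OF this(1)] d2(2)[OF this(2)] eq show False
    unfolding e_def dist_real_def by (smt (verit) field_sum_of_halves)
qed

section \<open>Closed fields on convex open sets\<close>

lemma has_derivative_along_line:
  fixes f :: "real ^ 'n::finite \<Rightarrow> real"
  assumes "f differentiable (at (u0 + s *\<^sub>R w))"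
  shows "((\<lambda>s. f (u0 + s *\<^sub>R w)) has_real_derivative (\<Sum>k\<in>UNIV. w $ k * pd k f (u0 + s *\<^sub>R w))) (at s)"
proof -
  have "((\<lambda>s. f (u0 + s *\<^sub>R w)) has_derivative
      (\<lambda>h. \<Sum>k\<in>UNIV. (h *\<^sub>R w) $ k * pd k f (u0 + s *\<^sub>R w))) (at s)"
    by (rule has_derivative_compose[where g = f])
      (use has_derivative_pd[OF assms] in \<open>auto intro!: derivative_eq_intros\<close>)
  moreover have "(\<lambda>h. \<Sum>k\<in>UNIV. (h *\<^sub>R w) $ k * pd k f (u0 + s *\<^sub>R w)) =
      (*) (\<Sum>k\<in>UNIV. w $ k * pd k f (u0 + s *\<^sub>R w))"
    by (simp add: fun_eq_iff sum_distrib_left mult_ac)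
  ultimately show ?thesis
    by (simp add: has_field_derivative_def)
qed

text \<open>The potential at \<open>y\<close> is the integral of the field along the segment from
  \<open>u0\<close> to \<open>y\<close>. Differentiation under the integral sign, together with
  closedness, turns the integrand into the total derivative of \<open>s * F i\<close> along the
  segment, whose integral is the value of \<open>F i\<close> at the endpoint.\<close>

lemma poincare_convex:
  fixes F :: "'n::finite \<Rightarrow> real ^ 'n \<Rightarrow> real"
  assumes D: "open D" "convex D" and u0: "u0 \<in> D"
    and F: "\<And>k. C1_on D (F k)"
    and sym: "\<And>u i j. u \<in> D \<Longrightarrow> pd j (F i) u = pd i (F j) u"
  shows "\<exists>\<Phi>. \<forall>u\<in>D. \<forall>i. ((\<lambda>h. \<Phi> (u + h *\<^sub>R axis i 1)) has_real_derivative F i u) (at 0)"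
proof (intro exI ballI allI)
  fix u i assume u: "u \<in> D"
  define G where "G y s = (\<Sum>k\<in>UNIV. (y - u0) $ k * F k (u0 + s *\<^sub>R (y - u0)))" for y s
  define p where "p h s = u0 + s *\<^sub>R (u + h *\<^sub>R axis i 1 - u0)" for h s
  \<comment> \<open>The derivative in \<open>h\<close> of the integrand
    \<open>G (u + h *\<^sub>R axis i 1) s\<close> by the product rule; \<open>p h s\<close> runs
    along the segment from \<open>u0\<close> to the perturbed endpoint.\<close>
  define G' where "G' h s = (\<Sum>k\<in>UNIV. (axis i 1 :: real ^ 'n) $ k * F k (p h s) +
      (u + h *\<^sub>R axis i 1 - u0) $ k * (s * pd i (F k) (p h s)))" for h s
  have diff: "F k differentiable (at y)" if "y \<in> D" for k y
    using F that by (auto simp: C1_on_def)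
  have contF: "continuous_on D (F k)" for k
    using diff by (intro differentiable_imp_continuous_on) (auto simp: differentiable_on_def intro: differentiable_at_withinI)
  have contpd: "continuous_on D (pd j (F k))" for j k
    using F by (auto simp: C1_on_def)
  obtain e where e: "0 < e" "ball u e \<subseteq> D"
    using D(1) u by (auto simp: open_contains_ball)
  let ?W = "{-e<..<e} :: real set"
  have p: "p h s \<in> D" if "h \<in> ?W" "s \<in> {0..1}" for h s
  proof -
    have "u + h *\<^sub>R axis i 1 \<in> D"
      using e(2) that(1) by (intro subsetD[OF e(2)]) (auto simp: dist_norm norm_axis_1)
    then have "(1 - s) *\<^sub>R u0 + s *\<^sub>R (u + h *\<^sub>R axis i 1) \<in> D"
      using that(2) D(2) u0 by (intro convexD_alt) auto
    then show ?thesis by (simp add: p_def algebra_simps)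
  qed
  have pcont: "continuous_on S (\<lambda>z. p (fst z) (snd z))" for S
    unfolding p_def by (intro continuous_intros)
  have "((\<lambda>h. integral (cbox 0 1) (\<lambda>s. G (u + h *\<^sub>R axis i 1) s)) has_field_derivative
      integral (cbox 0 1) (G' 0)) (at 0 within ?W)"
  proof (rule leibniz_rule_field_derivative)
    fix h s :: real assume h: "h \<in> ?W" and s: "s \<in> cbox 0 1"
    have "((\<lambda>h. F k (p h s)) has_real_derivative s * pd i (F k) (p h s)) (at h)" for k
    proof -
      have eq: "p h s = u0 + s *\<^sub>R (u - u0) + (s * h) *\<^sub>R axis i 1" for h
        by (simp add: p_def algebra_simps)
      have "F k differentiable (at (u0 + s *\<^sub>R (u - u0) + (s * h) *\<^sub>R axis i 1))"
        using diff[OF p[of h s], of k, unfolded eq] h s by simp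
      from has_real_derivative_pd[OF this]
      have dF: "((\<lambda>h. F k (u0 + s *\<^sub>R (u - u0) + h *\<^sub>R axis i 1)) has_real_derivative
          pd i (F k) (p h s)) (at (s * h))" by (simp add: eq)
      have lin: "((\<lambda>h. s * h) has_real_derivative s) (at h)"
        by (auto intro!: derivative_eq_intros)
      from DERIV_chain2[of "\<lambda>h. F k (u0 + s *\<^sub>R (u - u0) + h *\<^sub>R axis i 1)" "pd i (F k) (p h s)"
          "\<lambda>h. s * h" h s UNIV, OF dF lin] show ?thesis
        unfolding eq by (simp add: mult.commute)
    qed
    then have "((\<lambda>h. G (u + h *\<^sub>R axis i 1) s) has_real_derivative G' h s) (at h)"
      unfolding G_def G'_def p_def[symmetric]
      by (auto intro!: derivative_eq_intros sum.cong simp: algebra_simps)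
    then show "((\<lambda>h. G (u + h *\<^sub>R axis i 1) s) has_field_derivative G' h s) (at h within ?W)"
      by (rule has_field_derivative_at_within)
  next
    fix h assume h: "h \<in> ?W"
    show "(\<lambda>s. G (u + h *\<^sub>R axis i 1) s) integrable_on cbox 0 1"
      unfolding G_def p_def[symmetric]
      by (intro integrable_continuous continuous_intros continuous_on_compose2[OF contF])
        (use p h in \<open>auto simp: p_def intro!: continuous_intros\<close>)
  next
    show "continuous_on (?W \<times> cbox 0 1) (\<lambda>(h, s). G' h s)"
      unfolding G'_def split_beta
      by (intro continuous_intros continuous_on_compose2[OF contF _ image_subsetI]
          continuous_on_compose2[OF contpd _ image_subsetI] pcont)
        (use p in auto)
  qed (use e in auto)
  moreover have "at 0 within ?W = at 0"
    using e(1) by (intro at_within_open) auto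
  moreover have "integral (cbox 0 1) (G' 0) = F i u"
  proof -
    \<comment> \<open>Closedness replaces \<open>pd i (F k)\<close> by \<open>pd k (F i)\<close>, so
      the sum in \<open>G' 0 s\<close> becomes the derivative of \<open>F i\<close> along the
      segment. The antiderivative is 0 at \<open>s = 0\<close> and \<open>F i u\<close> at
      \<open>s = 1\<close>.\<close>
    have "((\<lambda>s. s * F i (p 0 s)) has_real_derivative G' 0 s) (at s)" if s: "s \<in> {0..1}" for s
    proof -
      have "F i differentiable (at (u0 + s *\<^sub>R (u - u0)))"
        using diff[OF p] s e(1) by (force simp: p_def)
      from has_derivative_along_line[OF this]
      have "((\<lambda>s. F i (p 0 s)) has_real_derivative
          (\<Sum>k\<in>UNIV. (u - u0) $ k * pd k (F i) (p 0 s))) (at s)"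
        by (simp add: p_def)
      moreover have "pd i (F k) (p 0 s) = pd k (F i) (p 0 s)" for k
        using sym p s e(1) by simp
      then have "G' 0 s = F i (p 0 s) + s * (\<Sum>k\<in>UNIV. (u - u0) $ k * pd k (F i) (p 0 s))"
        by (simp add: G'_def sum.distrib sum_distrib_left mult_ac axis_def if_distrib[of "\<lambda>c. c * _"]
            if_distrib[of "\<lambda>c. _ * c"] cong: if_cong)
      ultimately show ?thesis by (auto intro!: derivative_eq_intros)
    qed
    then have "(G' 0 has_integral (1 * F i (p 0 1) - 0 * F i (p 0 0))) {0..1}"
      by (intro fundamental_theorem_of_calculus)
        (auto simp: has_real_derivative_iff_has_vector_derivative intro: has_vector_derivative_at_within)
    then show ?thesis by (simp add: p_def integral_unique)
  qed
  \<comment> \<open>The witness left open by \<open>exI\<close> is fixed only here.\<close>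
  ultimately show "((\<lambda>h. (\<lambda>y. integral (cbox 0 1) (\<lambda>s. \<Sum>k\<in>UNIV. (y - u0) $ k * F k (u0 + s *\<^sub>R (y - u0))))
      (u + h *\<^sub>R axis i 1)) has_real_derivative F i u) (at 0)"
    by (simp add: G_def)
qed

section \<open>Action profiles\<close>

lemma profiles_eq_INT: "profiles U = (\<Inter>k. (\<lambda>u. u $ k) -` U)"
  by (auto simp: profiles_def)

text \<open>A ball around \<open>u\<close> contains every small move of a single coordinate, which
  gives one inclusion; for the other, a finite intersection of open preimages is open.\<close>

lemma interior_profiles: "interior (profiles U :: (real ^ 'n::finite) set) = profiles (interior U)"
proof
  show "interior (profiles U) \<subseteq> (profiles (interior U) :: (real ^ 'n) set)"
  proof
    fix u :: "real ^ 'n" assume "u \<in> interior (profiles U)"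
    then obtain e where e: "0 < e" "ball u e \<subseteq> profiles U"
      by (auto simp: mem_interior)
    have "ball (u $ k) e \<subseteq> U" for k
    proof
      fix a assume a: "a \<in> ball (u $ k) e"
      have "u + (a - u $ k) *\<^sub>R axis k 1 \<in> profiles U"
        using a by (intro subsetD[OF e(2)]) (auto simp: dist_norm norm_axis_1)
      then have "(u + (a - u $ k) *\<^sub>R axis k 1) $ k \<in> U"
        unfolding profiles_def by blast
      then show "a \<in> U" by (simp add: axis_def)
    qed
    then show "u \<in> profiles (interior U)"
      using e(1) by (auto simp: profiles_def mem_interior)
  qed
  have "open ((\<lambda>u :: real ^ 'n. u $ k) -` interior U)" for k
    by (intro open_vimage continuous_intros) auto
  then have "open (profiles (interior U) :: (real ^ 'n) set)"
    unfolding profiles_eq_INT by (intro open_INT) auto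
  then show "(profiles (interior U) :: (real ^ 'n) set) \<subseteq> interior (profiles U)"
    by (intro interior_maximal) (auto simp: profiles_def dest: subsetD[OF interior_subset])
qed

lemma convex_profiles: "convex A \<Longrightarrow> convex (profiles A :: (real ^ 'n::finite) set)"
  unfolding profiles_def convex_def by auto

lemma connected_profilesD:
  assumes "connected (profiles A :: (real ^ 'n::finite) set)"
  shows "connected A"
proof -
  have "(\<lambda>u :: real ^ 'n. u $ k) ` profiles A = A" for k
  proof
    show "A \<subseteq> (\<lambda>u :: real ^ 'n. u $ k) ` profiles A"
      by (auto simp: profiles_def intro!: image_eqI[of _ _ "\<chi> _. a" for a])
  qed (auto simp: profiles_def)
  with connected_continuous_image[OF _ assms, of "\<lambda>u. u $ undefined"] show ?thesis
    by (simp add: continuous_on_component)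
qed

lemma join_in_profiles:
  assumes "a \<in> U" "w \<in> opponent_profiles U i"
  shows "join i a w \<in> profiles U"
  using assms by (auto simp: profiles_def join_def opponent_profiles_def)

lemma others_in_opponent_profiles: "u \<in> profiles U \<Longrightarrow> others i u \<in> opponent_profiles U i"
  by (auto simp: profiles_def others_def opponent_profiles_def)

lemma join_others: "join i a (others i u) = u + (a - u $ i) *\<^sub>R axis i 1"
  by (auto simp: join_def others_def vec_eq_iff axis_def)

lemma join_others_self [simp]: "join i (u $ i) (others i u) = u"
  by (simp add: join_others)

text \<open>Switching the coordinates one after another from \<open>u0\<close> to \<open>u\<close>
  gives a path of profiles, each obtained from its predecessor by a deviation of a single player.
  Arguments that know a function only along coordinate lines telescope over this path.\<close>

definition mix :: "'n set \<Rightarrow> real ^ 'n \<Rightarrow> real ^ 'n \<Rightarrow> real ^ 'n" where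
  "mix S u0 u = (\<chi> k. if k \<in> S then u $ k else u0 $ k)"

lemma mix_empty [simp]: "mix {} u0 u = u0"
  and mix_UNIV [simp]: "mix UNIV u0 u = u"
  and mix_in_profiles: "u0 \<in> profiles U \<Longrightarrow> u \<in> profiles U \<Longrightarrow> mix S u0 u \<in> profiles U"
  by (auto simp: mix_def profiles_def vec_eq_iff)

lemma mix_insert:
  "i \<notin> S \<Longrightarrow> mix (insert i S) u0 u = join i (u $ i) (others i (mix S u0 u))"
  by (auto simp: mix_def join_def others_def vec_eq_iff)

section \<open>Exact potentials, response potentials and the cross condition\<close>

lemma exact_potentialD:
  assumes "exact_potential H U P" "u \<in> profiles U" "a \<in> U"
  shows "P (join i a (others i u)) - P u = H i (join i a (others i u)) - H i u"
proof -
  have "u $ i \<in> U" using assms(2) by (auto simp: profiles_def)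
  then show ?thesis
    using assms others_in_opponent_profiles[OF assms(2), of i] unfolding exact_potential_def
    by (metis join_others_self)
qed

text \<open>On a line parallel to the \<open>i\<close>-th axis, \<open>P\<close> and
  \<open>H i\<close> differ by a constant as long as the moving coordinate stays in the open set
  \<open>interior U\<close>. Hence \<open>P\<close> inherits the derivative of \<open>H i\<close>
  there, with no smoothness of \<open>P\<close> presupposed.\<close>

lemma exact_potential_imp_response_potential:
  fixes H :: "'n::finite \<Rightarrow> real ^ 'n \<Rightarrow> real"
  assumes pot: "exact_potential H U P" and c: "\<And>i. \<gamma> i = c" "c \<noteq> 0"
    and H: "\<And>i. C1_on (profiles (interior U)) (H i)"
  shows "response_potential H \<gamma> (profiles (interior U)) (\<lambda>u. P u / c)"
  unfolding response_potential_def
proof (intro ballI allI)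
  fix u i assume u: "u \<in> (profiles (interior U) :: (real ^ 'n) set)"
  then have uU: "u \<in> profiles U" and ui: "u $ i \<in> interior U"
    using interior_subset by (auto simp: profiles_def)
  have "H i differentiable (at (u + 0 *\<^sub>R axis i 1))"
    using H u by (simp add: C1_on_def)
  from has_real_derivative_pd[OF this]
  have "((\<lambda>h. H i (u + h *\<^sub>R axis i 1)) has_real_derivative pd i (H i) u) (at 0)"
    by simp
  then have "((\<lambda>h. (P u + (H i (u + h *\<^sub>R axis i 1) - H i u)) / c) has_real_derivative
      1 / \<gamma> i * pd i (H i) u) (at 0)"
    using c by (auto intro!: derivative_eq_intros)
  moreover have "open ((\<lambda>h. u $ i + h) -` interior U)"
    by (intro open_vimage continuous_intros) auto
  moreover have "0 \<in> (\<lambda>h. u $ i + h) -` interior U"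
    using ui by simp
  moreover have "(P u + (H i (u + h *\<^sub>R axis i 1) - H i u)) / c = P (u + h *\<^sub>R axis i 1) / c"
    if "h \<in> (\<lambda>h. u $ i + h) -` interior U" for h
    using exact_potentialD[OF pot uU, of "u $ i + h" i] that interior_subset[of U]
    by (auto simp: join_others)
  ultimately show "((\<lambda>h. P (u + h *\<^sub>R axis i 1) / c) has_real_derivative 1 / \<gamma> i * pd i (H i) u) (at 0)"
    by (rule has_field_derivative_transform_within_open)
qed

text \<open>The difference of two potentials has zero partial derivatives, so it is constant when
  one coordinate moves in the convex set \<open>A\<close>; moving the coordinates in turn links
  every profile to a base point.\<close>

lemma response_potential_unique:
  fixes H :: "'n::finite \<Rightarrow> real ^ 'n \<Rightarrow> real"
  assumes A: "convex A" "profiles A \<noteq> ({} :: (real ^ 'n) set)"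
    and \<Phi>: "response_potential H \<gamma> (profiles A) \<Phi>" and \<Psi>: "response_potential H \<gamma> (profiles A) \<Psi>"
  shows "\<exists>d. \<forall>u\<in>profiles A. \<Phi> u = \<Psi> u + d"
proof -
  let ?q = "\<lambda>u. \<Phi> u - \<Psi> u"
  obtain u0 :: "real ^ 'n" where u0: "u0 \<in> profiles A" using A by blast
  have step: "?q (join i a (others i u)) = ?q u" if u: "u \<in> profiles A" and a: "a \<in> A" for u a i
  proof -
    have ui: "u $ i \<in> A" using u by (auto simp: profiles_def)
    have "((\<lambda>s. ?q (join i s (others i u))) has_field_derivative 0) (at s within A)" if s: "s \<in> A" for s
    proof -
      let ?y = "u + (s - u $ i) *\<^sub>R axis i 1"
      have "?y \<in> profiles A"
        using join_in_profiles[OF s others_in_opponent_profiles[OF u], of i] by (simp add: join_others)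
      with \<Phi> \<Psi> have "((\<lambda>h. \<Phi> (?y + h *\<^sub>R axis i 1)) has_real_derivative 1 / \<gamma> i * pd i (H i) ?y) (at 0)"
        "((\<lambda>h. \<Psi> (?y + h *\<^sub>R axis i 1)) has_real_derivative 1 / \<gamma> i * pd i (H i) ?y) (at 0)"
        by (auto simp: response_potential_def)
      from DERIV_diff[OF this]
      have "((\<lambda>h. ?q (?y + h *\<^sub>R axis i 1)) has_real_derivative 0) (at 0)" by simp
      then have "((\<lambda>h. ?q (join i (s + h) (others i u))) has_real_derivative 0) (at 0)"
        by (simp add: join_others algebra_simps)
      then have "((\<lambda>s. ?q (join i s (others i u))) has_real_derivative 0) (at s)"
        using DERIV_shift[of "\<lambda>s. ?q (join i s (others i u))" 0 0 s] by (simp add: add.commute)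
      then show ?thesis by (rule has_field_derivative_at_within)
    qed
    from has_field_derivative_zero_constant[OF A(1) this]
    obtain d where "\<And>s. s \<in> A \<Longrightarrow> ?q (join i s (others i u)) = d" by blast
    from this[OF a] this[OF ui] show ?thesis by simp
  qed
  have "?q (mix S u0 u) = ?q u0" if u: "u \<in> profiles A" and "finite S" for S u
    using \<open>finite S\<close>
  proof induction
    case (insert i S)
    have "?q (mix (insert i S) u0 u) = ?q (mix S u0 u)"
      unfolding mix_insert[OF insert.hyps(2)]
      by (rule step) (use u mix_in_profiles[OF u0 u] in \<open>auto simp: profiles_def\<close>)
    with insert.IH show ?case by simp
  qed simp
  from this[of _ UNIV] have "\<Phi> u = \<Psi> u + ?q u0" if "u \<in> profiles A" for u
    using that by (simp add: algebra_simps)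
  then show ?thesis by blast
qed

text \<open>The cross condition is closedness of the field \<open>?F\<close>, the case
  \<open>i = j\<close> being trivial. Thus \<open>poincare_convex\<close> yields one implication and
  \<open>pd_symmetric\<close> the other.\<close>

lemma cross_condition_iff_response_potential:
  fixes H :: "'n::finite \<Rightarrow> real ^ 'n \<Rightarrow> real"
  assumes D: "open D" "convex D" "D \<noteq> {}" and H: "\<And>i. C2_on D (H i)"
  shows "(\<forall>u\<in>D. \<forall>i j. i \<noteq> j \<longrightarrow>
      1 / \<gamma> i * pd j (pd i (H i)) u = 1 / \<gamma> j * pd i (pd j (H j)) u) \<longleftrightarrow>
    (\<exists>\<Phi>. response_potential H \<gamma> D \<Phi>)"
proof -
  let ?F = "\<lambda>i u. 1 / \<gamma> i * pd i (H i) u"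
  have pdF: "pd j (?F i) u = 1 / \<gamma> i * pd j (pd i (H i)) u" if "u \<in> D" for i j u
  proof -
    have "pd i (H i) differentiable (at (u + 0 *\<^sub>R axis j 1))"
      using H that by (simp add: C2_on_def C1_on_def)
    from DERIV_cmult[OF has_real_derivative_pd[OF this], of "1 / \<gamma> i"]
    have "((\<lambda>h. ?F i (u + h *\<^sub>R axis j 1)) has_real_derivative 1 / \<gamma> i * pd j (pd i (H i)) u) (at 0)"
      by simp
    then show ?thesis
      unfolding pd_def[of j "?F i"] by (rule DERIV_imp_deriv)
  qed
  have F: "C1_on D (?F i)" for i
    unfolding C1_on_def
  proof (intro conjI ballI allI)
    show "?F i differentiable (at u)" if "u \<in> D" for u
      using H that by (intro derivative_intros) (auto simp: C2_on_def C1_on_def)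
    show "continuous_on D (pd j (?F i))" for j
      by (subst continuous_on_cong[OF refl pdF])
        (use H in \<open>auto simp: C2_on_def C1_on_def intro!: continuous_on_mult_left simp del: times_divide_eq_left\<close>)
  qed
  show ?thesis
  proof
    assume *: "\<forall>u\<in>D. \<forall>i j. i \<noteq> j \<longrightarrow>
      1 / \<gamma> i * pd j (pd i (H i)) u = 1 / \<gamma> j * pd i (pd j (H j)) u"
    have "pd j (?F i) u = pd i (?F j) u" if "u \<in> D" for u i j
      unfolding pdF[OF that] using * that by (cases "i = j") auto
    with D F show "\<exists>\<Phi>. response_potential H \<gamma> D \<Phi>"
      unfolding response_potential_def using poincare_convex[of D _ ?F] by blast
  next
    assume "\<exists>\<Phi>. response_potential H \<gamma> D \<Phi>"
    then obtain \<Phi> where \<Phi>: "\<And>y k. y \<in> D \<Longrightarrow> ((\<lambda>h. \<Phi> (y + h *\<^sub>R axis k 1)) has_real_derivative ?F k y) (at 0)"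
      by (auto simp: response_potential_def)
    show "\<forall>u\<in>D. \<forall>i j. i \<noteq> j \<longrightarrow>
      1 / \<gamma> i * pd j (pd i (H i)) u = 1 / \<gamma> j * pd i (pd j (H j)) u"
    proof (intro ballI allI impI)
      fix u i j assume u: "u \<in> D"
      show "1 / \<gamma> i * pd j (pd i (H i)) u = 1 / \<gamma> j * pd i (pd j (H j)) u"
        using pd_symmetric[OF D(1) u \<Phi> F, of j i] unfolding pdF[OF u] .
    qed
  qed
qed

section \<open>Fubini for action profiles\<close>

text \<open>The measure of the set where \<open>Q x\<close> fails is a Tonelli integral, hence
  measurable in \<open>x\<close>, and the predicate says that it vanishes.\<close>

lemma pred_AE:
  assumes N: "sigma_finite_measure N" and [measurable]: "Measurable.pred (M \<Otimes>\<^sub>M N) (\<lambda>(x, y). Q x y)"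
  shows "Measurable.pred M (\<lambda>x. AE y in N. Q x y)"
proof -
  interpret N: sigma_finite_measure N by fact
  let ?g = "\<lambda>x. \<integral>\<^sup>+ y. indicator {z \<in> space (M \<Otimes>\<^sub>M N). \<not> (\<lambda>(x, y). Q x y) z} (x, y) \<partial>N"
  have "(AE y in N. Q x y) \<longleftrightarrow> ?g x = 0" if x: "x \<in> space M" for x
  proof -
    have "?g x = 0 \<longleftrightarrow> (AE y in N. indicator {z \<in> space (M \<Otimes>\<^sub>M N). \<not> (\<lambda>(x, y). Q x y) z} (x, y) = (0 :: ennreal))"
      using x by (intro nn_integral_0_iff_AE) measurable
    also have "\<dots> \<longleftrightarrow> (AE y in N. Q x y)"
      using x by (intro AE_cong) (auto simp: indicator_def space_pair_measure)
    finally show ?thesis ..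
  qed
  moreover have "Measurable.pred M (\<lambda>x. ?g x = 0)" by measurable
  ultimately show ?thesis by (simp cong: measurable_cong)
qed

lemma AE_swap:
  assumes "sigma_finite_measure M" "sigma_finite_measure N"
    and "Measurable.pred (M \<Otimes>\<^sub>M N) (\<lambda>(x, y). Q x y)"
    and "AE x in M. AE y in N. Q x y"
  shows "AE y in N. AE x in M. Q x y"
proof -
  interpret pair_sigma_finite M N using assms by (intro pair_sigma_finite.intro)
  show ?thesis using assms(3,4) AE_commute[of Q] by (simp add: pred_def split_beta)
qed

interpretation lborel_PiM: product_sigma_finite "\<lambda>_. lborel :: real measure" ..

text \<open>Tonelli for the indicator of the failure set: the double integral is zero exactly if
  almost every inner integral is.\<close>

lemma AE_PiM_insert:
  assumes I: "finite I" "i \<notin> I"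
    and [measurable]: "Measurable.pred (PiM (insert i I) (\<lambda>_. lborel :: real measure)) Q"
  shows "(AE w in PiM (insert i I) (\<lambda>_. lborel). Q w) \<longleftrightarrow>
    (AE w in PiM I (\<lambda>_. lborel). AE a in lborel. Q (w(i := a)))"
proof -
  let ?M = "\<lambda>I. PiM I (\<lambda>_. lborel :: real measure)"
  interpret sigma_finite_measure "?M I" using lborel_PiM.sigma_finite I by blast
  define g where "g w = (if Q w then 0 else 1 :: ennreal)" for w
  have g[measurable]: "g \<in> borel_measurable (?M (insert i I))"
    unfolding g_def by measurable
  have "(AE w in ?M (insert i I). Q w) \<longleftrightarrow> (AE w in ?M (insert i I). g w = 0)"
    by (auto simp: g_def)
  also have "\<dots> \<longleftrightarrow> (\<integral>\<^sup>+ w. g w \<partial>?M (insert i I)) = 0"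
    by (subst nn_integral_0_iff_AE) auto
  also have "\<dots> \<longleftrightarrow> (\<integral>\<^sup>+ w. \<integral>\<^sup>+ a. g (w(i := a)) \<partial>lborel \<partial>?M I) = 0"
    by (subst lborel_PiM.product_nn_integral_insert[OF I]) auto
  also have "\<dots> \<longleftrightarrow> (AE w in ?M I. (\<integral>\<^sup>+ a. g (w(i := a)) \<partial>lborel) = 0)"
    by (intro nn_integral_0_iff_AE) measurable
  also have "\<dots> \<longleftrightarrow> (AE w in ?M I. AE a in lborel. g (w(i := a)) = 0)"
    by (intro AE_cong nn_integral_0_iff_AE) measurable
  also have "\<dots> \<longleftrightarrow> (AE w in ?M I. AE a in lborel. Q (w(i := a)))"
    by (auto simp: g_def)
  finally show ?thesis .
qed

text \<open>Lets a generic value of a coordinate be fixed inside a set of positive measure.\<close>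

lemma AE_ex_in_set:
  assumes "AE x in M. P x" "A \<in> sets M" "emeasure M A \<noteq> 0"
  shows "\<exists>x\<in>A. P x"
proof (rule ccontr)
  assume "\<not> (\<exists>x\<in>A. P x)"
  with assms(1) have "AE x in M. x \<notin> A" by (auto elim: eventually_mono)
  with assms(2) have "A \<in> null_sets M" by (simp add: AE_iff_null_sets)
  with assms(3) show False by auto
qed

text \<open>
  The hypothesis compares two points on a coordinate line instead of asserting that \<open>f\<close> is almost
  everywhere constant on it: in this form it is measurable in the other coordinates and can be passed
  through Fubini's theorem.
\<close>

lemma AE_constant_if_coordinatewise:
  fixes f :: "('i \<Rightarrow> real) \<Rightarrow> real"
  assumes "finite I" and U[measurable]: "U \<in> sets borel" and pos: "emeasure lborel U \<noteq> 0"
    and "f \<in> borel_measurable (PiM I (\<lambda>_. lborel))"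
    and "\<And>i. i \<in> I \<Longrightarrow> AE w in PiM (I - {i}) (\<lambda>_. lborel). AE a in lborel. AE b in lborel.
      (\<forall>j\<in>I - {i}. w j \<in> U) \<and> a \<in> U \<and> b \<in> U \<longrightarrow> f (w(i := a)) = f (w(i := b))"
  shows "\<exists>k. AE w in PiM I (\<lambda>_. lborel). (\<forall>j\<in>I. w j \<in> U) \<longrightarrow> f w = k"
  using assms(1,4,5)
proof (induction I arbitrary: f)
  case empty
  \<comment> \<open>The product over the empty index set has the single point
    \<open>\<lambda>_. undefined\<close>.\<close>
  then show ?case by (intro exI[of _ "f (\<lambda>_. undefined)"] AE_I2) (simp add: space_PiM)
next
  case (insert i I)
  let ?M = "\<lambda>I. PiM I (\<lambda>_. lborel :: real measure)"
  note f[measurable] = insert.prems(1)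
  have sf: "sigma_finite_measure (?M (I - A))" "sigma_finite_measure (?M I)" for A
    using lborel_PiM.sigma_finite insert.hyps(1) by auto
  have sl: "sigma_finite_measure (lborel :: real measure)" by (rule sigma_finite_lborel)
  have "AE w in ?M I. AE a in lborel. AE b in lborel.
      (\<forall>j\<in>I. w j \<in> U) \<and> a \<in> U \<and> b \<in> U \<longrightarrow> f (w(i := a)) = f (w(i := b))"
    using insert.prems(2)[OF insertI1] unfolding Diff_insert_absorb[OF insert.hyps(2)] .
  \<comment> \<open>The value of coordinate \<open>i\<close> becomes the outermost variable, so that
    one generic value can later serve this statement and all the statements
    \<open>2\<close>.\<close>
  then have 1: "AE a in lborel. AE w in ?M I. AE b in lborel.
      (\<forall>j\<in>I. w j \<in> U) \<and> a \<in> U \<and> b \<in> U \<longrightarrow> f (w(i := a)) = f (w(i := b))"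
  proof (rule AE_swap[OF sf(2) sl, rotated])
    show "Measurable.pred (?M I \<Otimes>\<^sub>M lborel) (\<lambda>(w, a). AE b in lborel.
      (\<forall>j\<in>I. w j \<in> U) \<and> a \<in> U \<and> b \<in> U \<longrightarrow> f (w(i := a)) = f (w(i := b)))"
      unfolding split_beta using insert.hyps(1)
      by (intro pred_AE[OF sl]) measurable
  qed
  \<comment> \<open>For another coordinate \<open>j\<close>, coordinate \<open>i\<close> is split
    off from the remaining ones and moved outermost as \<open>c\<close>. What stays inside is the
    premise of the induction hypothesis for \<open>f\<close> frozen at \<open>c\<close>.\<close>
  have 2: "AE c in lborel. AE w in ?M (I - {j}). AE a in lborel. AE b in lborel.
      (\<forall>k\<in>I - {j}. w k \<in> U) \<and> c \<in> U \<and> a \<in> U \<and> b \<in> U \<longrightarrow> f (w(j := a, i := c)) = f (w(j := b, i := c))"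
    if j: "j \<in> I" for j
  proof -
    have ij: "i \<noteq> j" "i \<notin> I" and e: "insert i I - {j} = insert i (I - {j})"
      using j insert.hyps by auto
    let ?Q = "\<lambda>w. AE a in lborel. AE b in lborel.
      (\<forall>k\<in>insert i (I - {j}). w k \<in> U) \<and> a \<in> U \<and> b \<in> U \<longrightarrow> f (w(j := a)) = f (w(j := b))"
    have eq: "insert i I = insert i (I - {j}) \<union> {j}" using j by auto
    have [measurable]: "(\<lambda>x. (g x)(j := h x)) \<in> N \<rightarrow>\<^sub>M ?M (insert i I)"
      if "g \<in> N \<rightarrow>\<^sub>M ?M (insert i (I - {j}))" "h \<in> N \<rightarrow>\<^sub>M lborel" for g h and N :: "'z measure"
      using that by (rule measurable_fun_upd[OF eq])
    have Q[measurable]: "Measurable.pred (?M (insert i (I - {j}))) ?Q"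
      using insert.hyps(1) 
      by (intro pred_AE[OF sl], unfold split_beta, intro pred_AE[OF sl], unfold split_beta) measurable
    have "AE w in ?M (insert i (I - {j})). ?Q w"
      using insert.prems(2)[OF insertI2[OF j]] unfolding e .
    then have "AE w in ?M (I - {j}). AE c in lborel. ?Q (w(i := c))"
      using AE_PiM_insert[OF _ _ Q] insert.hyps by auto
    then have "AE c in lborel. AE w in ?M (I - {j}). ?Q (w(i := c))"
      by (rule AE_swap[OF sf(1) sl, rotated]) (unfold split_beta, measurable)
    then show ?thesis
      by (elim eventually_mono) (use ij in \<open>auto simp: fun_upd_twist[of i j] elim!: eventually_mono\<close>)
  qed
  have "AE c in lborel. (AE w in ?M I. AE b in lborel.
      (\<forall>j\<in>I. w j \<in> U) \<and> c \<in> U \<and> b \<in> U \<longrightarrow> f (w(i := c)) = f (w(i := b))) \<and>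
    (\<forall>j\<in>I. AE w in ?M (I - {j}). AE a in lborel. AE b in lborel.
      (\<forall>k\<in>I - {j}. w k \<in> U) \<and> c \<in> U \<and> a \<in> U \<and> b \<in> U \<longrightarrow> f (w(j := a, i := c)) = f (w(j := b, i := c)))"
    using 1 2 insert.hyps(1) by (intro AE_conjI AE_finite_allI)
  \<comment> \<open>Freezing coordinate \<open>i\<close> at a generic \<open>c\<close> leaves a function of the coordinates in \<open>I\<close>.\<close>
  from AE_ex_in_set[OF this _ pos] obtain c where c: "c \<in> U"
    and c1: "AE w in ?M I. AE b in lborel.
      (\<forall>j\<in>I. w j \<in> U) \<and> c \<in> U \<and> b \<in> U \<longrightarrow> f (w(i := c)) = f (w(i := b))"
    and c2: "\<And>j. j \<in> I \<Longrightarrow> AE w in ?M (I - {j}). AE a in lborel. AE b in lborel.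
      (\<forall>k\<in>I - {j}. w k \<in> U) \<and> c \<in> U \<and> a \<in> U \<and> b \<in> U \<longrightarrow> f (w(j := a, i := c)) = f (w(j := b, i := c))"
    by auto
  have "\<exists>k. AE w in ?M I. (\<forall>j\<in>I. w j \<in> U) \<longrightarrow> f (w(i := c)) = k"
  proof (rule insert.IH)
    show "(\<lambda>w. f (w(i := c))) \<in> borel_measurable (?M I)" by measurable
    show "AE w in ?M (I - {j}). AE a in lborel. AE b in lborel.
      (\<forall>k\<in>I - {j}. w k \<in> U) \<and> a \<in> U \<and> b \<in> U \<longrightarrow> f (w(j := a, i := c)) = f (w(j := b, i := c))"
      if "j \<in> I" for j
      using c2[OF that] c by simp
  qed
  then obtain k where "AE w in ?M I. (\<forall>j\<in>I. w j \<in> U) \<longrightarrow> f (w(i := c)) = k" by blast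
  \<comment> \<open>By \<open>c1\<close> the value at almost every \<open>b\<close> equals the value
    at \<open>c\<close>, which is \<open>k\<close> by induction.\<close>
  with c1 have "AE w in ?M I. AE b in lborel. (\<forall>j\<in>insert i I. (w(i := b)) j \<in> U) \<longrightarrow> f (w(i := b)) = k"
  proof eventually_elim
    case (elim w)
    from elim(1) show ?case
      by eventually_elim (use elim(2) c insert.hyps(2) in \<open>auto split: if_splits\<close>)
  qed
  then have "AE w in ?M (insert i I). (\<forall>j\<in>insert i I. w j \<in> U) \<longrightarrow> f w = k"
    using insert.hyps by (subst AE_PiM_insert) (auto simp del: fun_upd_apply)
  then show ?case by blast
qed

section \<open>Lebesgue measure on vectors as a product measure\<close>

lemma measurable_vec_lambda_PiM [measurable]:
  "(\<lambda>w. \<chi> k::'n::finite. w k) \<in> PiM UNIV (\<lambda>_. lborel :: real measure) \<rightarrow>\<^sub>M borel"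
proof -
  have "(\<lambda>w. \<Sum>k\<in>(UNIV :: 'n set). w k *\<^sub>R (axis k 1 :: real ^ 'n)) \<in>
      PiM UNIV (\<lambda>_. lborel :: real measure) \<rightarrow>\<^sub>M borel"
    by measurable
  moreover have "(\<Sum>k\<in>(UNIV :: 'n set). w k *\<^sub>R (axis k 1 :: real ^ 'n)) = (\<chi> k. w k)" for w
    using basis_expansion[of "\<chi> k. w k"] by (simp add: scalar_mult_eq_scaleR)
  ultimately show ?thesis by simp
qed

text \<open>Lebesgue measure is determined by its values on boxes, and the image of the product
  measure gives a box the product of its side lengths.\<close>

lemma lborel_vec: "(lborel :: (real ^ 'n::finite) measure) = distr (PiM UNIV (\<lambda>_. lborel)) borel (\<lambda>w. \<chi> k. w k)"
proof (rule lborel_eqI)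
  fix l u :: "real ^ 'n" assume lu: "\<And>b. b \<in> Basis \<Longrightarrow> l \<bullet> b \<le> u \<bullet> b"
  have le: "l $ k \<le> u $ k" for k
    using lu[of "axis k 1"] by (simp add: inner_axis axis_in_Basis_iff)
  have "emeasure (distr (PiM UNIV (\<lambda>_. lborel)) borel (\<lambda>w. \<chi> k. w k)) (box l u) =
      emeasure (PiM UNIV (\<lambda>_. lborel)) (\<Pi>\<^sub>E k\<in>UNIV. {l $ k <..< u $ k})"
    by (subst emeasure_distr) (auto simp: mem_box_cart space_PiM PiE_def Pi_def intro!: arg_cong[where f = "emeasure _"])
  also have "\<dots> = (\<Prod>k\<in>UNIV. ennreal (u $ k - l $ k))"
    using le by (subst lborel_PiM.emeasure_PiM) auto
  also have "\<dots> = ennreal (\<Prod>k\<in>UNIV. u $ k - l $ k)"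
    using le by (intro prod_ennreal) auto
  also have "(\<Prod>k\<in>UNIV. u $ k - l $ k) = (\<Prod>b\<in>(\<lambda>k. axis k 1) ` UNIV. (u - l) \<bullet> b)"
    by (subst prod.reindex) (auto simp: inj_on_def axis_eq_axis inner_axis)
  also have "(\<lambda>k. axis k 1) ` UNIV = (Basis :: (real ^ 'n) set)"
    by (auto simp: Basis_vec_def)
  finally show "emeasure (distr (PiM UNIV (\<lambda>_. lborel)) borel (\<lambda>w. \<chi> k. w k)) (box l u) =
      ennreal (\<Prod>b\<in>Basis. (u - l) \<bullet> b)" .
qed simp

lemma vec_lambda_fun_upd: "(\<chi> k. (w(i := a)) k) = join i a w"
  by (auto simp: join_def vec_eq_iff)

lemma measurable_join [measurable]:
  "(\<lambda>(w, a). join i a w) \<in> PiM (UNIV - {i :: 'n::finite}) (\<lambda>_. lborel :: real measure) \<Otimes>\<^sub>M lborel \<rightarrow>\<^sub>M borel"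
proof -
  have eq: "(UNIV :: 'n set) = (UNIV - {i}) \<union> {i}" by auto
  have "(\<lambda>x. (fst x)(i := snd x)) \<in> PiM (UNIV - {i}) (\<lambda>_. lborel :: real measure) \<Otimes>\<^sub>M lborel \<rightarrow>\<^sub>M PiM UNIV (\<lambda>_. lborel)"
    by (rule measurable_fun_upd[OF eq]) measurable
  from measurable_compose[OF this measurable_vec_lambda_PiM] show ?thesis
    by (simp add: vec_lambda_fun_upd split_beta del: fun_upd_apply)
qed

lemma AE_lborel_vec:
  assumes [measurable]: "Measurable.pred borel Q"
  shows "(AE u :: real ^ 'n::finite in lborel. Q u) \<longleftrightarrow> (AE w in PiM UNIV (\<lambda>_. lborel). Q (\<chi> k. w k))"
  by (subst lborel_vec, subst AE_distr_iff) (auto simp: pred_def[symmetric])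

lemma nn_integral_lborel_join:
  fixes f :: "real ^ 'n::finite \<Rightarrow> ennreal"
  assumes [measurable]: "f \<in> borel_measurable borel"
  shows "(\<integral>\<^sup>+ u. f u \<partial>lborel) = (\<integral>\<^sup>+ w. \<integral>\<^sup>+ a. f (join i a w) \<partial>lborel \<partial>PiM (UNIV - {i}) (\<lambda>_. lborel))"
proof -
  have ins: "insert i (UNIV - {i}) = (UNIV :: 'n set)" by auto
  have "(\<integral>\<^sup>+ u. f u \<partial>lborel) = (\<integral>\<^sup>+ w. f (\<chi> k. w k) \<partial>PiM (insert i (UNIV - {i})) (\<lambda>_. lborel))"
    by (subst lborel_vec, subst nn_integral_distr) (auto simp: ins)
  also have "\<dots> = (\<integral>\<^sup>+ w. \<integral>\<^sup>+ a. f (\<chi> k. (w(i := a)) k) \<partial>lborel \<partial>PiM (UNIV - {i}) (\<lambda>_. lborel))"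
    by (rule lborel_PiM.product_nn_integral_insert) (auto simp: ins)
  finally show ?thesis unfolding vec_lambda_fun_upd .
qed

text \<open>A finite iterated integral of the norm has finite inner integrals almost
  everywhere.\<close>

lemma AE_integrable_join:
  fixes f :: "real ^ 'n::finite \<Rightarrow> real"
  assumes f: "integrable lborel f"
  shows "AE w in PiM (UNIV - {i}) (\<lambda>_. lborel). integrable lborel (\<lambda>a. f (join i a w))"
proof -
  let ?M = "PiM (UNIV - {i}) (\<lambda>_. lborel :: real measure)"
  have [measurable]: "f \<in> borel_measurable borel"
    using f by auto
  have "(\<integral>\<^sup>+ w. \<integral>\<^sup>+ a. norm (f (join i a w)) \<partial>lborel \<partial>?M) < \<infinity>"
    using f nn_integral_lborel_join[of "\<lambda>u. ennreal (norm (f u))" i] by (simp add: integrable_iff_bounded)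
  then have "AE w in ?M. (\<integral>\<^sup>+ a. norm (f (join i a w)) \<partial>lborel) \<noteq> \<infinity>"
    by (intro nn_integral_PInf_AE) (auto simp: infinity_ennreal_def)
  then show ?thesis
    \<comment> \<open>The section at \<open>w\<close> is measurable for \<open>w\<close> in the
      space of the product measure.\<close>
    using AE_space
  proof eventually_elim
    case (elim w)
    then have "(\<lambda>a. f (join i a w)) \<in> borel_measurable lborel"
      by measurable
    with elim(1) show ?case
      by (simp add: integrable_iff_bounded top.not_eq_extremum infinity_ennreal_def)
  qed
qed

text \<open>Transfers \<open>AE_constant_if_coordinatewise\<close> from the product space to
  vectors; constancy on almost every coordinate line supplies the two-point form required
  there.\<close>

lemma AE_constant_on_profiles:
  fixes r :: "real ^ 'n::finite \<Rightarrow> real"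
  assumes U[measurable]: "U \<in> sets borel" and pos: "emeasure lborel U \<noteq> 0"
    and r[measurable]: "r \<in> borel_measurable borel"
    and const: "\<And>i. AE w in PiM (UNIV - {i}) (\<lambda>_. lborel). w \<in> opponent_profiles U i \<longrightarrow>
      (\<exists>k. AE a in lborel. a \<in> U \<longrightarrow> r (join i a w) = k)"
  shows "\<exists>k. AE u in lborel. u \<in> profiles U \<longrightarrow> r u = k"
proof -
  have "\<exists>k. AE w in PiM UNIV (\<lambda>_. lborel). (\<forall>j\<in>UNIV. w j \<in> U) \<longrightarrow> r (\<chi> j. w j) = k"
  proof (rule AE_constant_if_coordinatewise)
    fix i :: 'n
    show "AE w in PiM (UNIV - {i}) (\<lambda>_. lborel). AE a in lborel. AE b in lborel.
      (\<forall>j\<in>UNIV - {i}. w j \<in> U) \<and> a \<in> U \<and> b \<in> U \<longrightarrow> r (\<chi> j. (w(i := a)) j) = r (\<chi> j. (w(i := b)) j)"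
      using const[of i] AE_space
    proof eventually_elim
      case (elim w)
      show ?case
      proof (cases "\<forall>j\<in>UNIV - {i}. w j \<in> U")
        case True
        \<comment> \<open>Members of \<open>opponent_profiles\<close> are extensional, which
          \<open>AE_space\<close> provides.\<close>
        with elim(2) have "w \<in> opponent_profiles U i"
          by (auto simp: opponent_profiles_def space_PiM PiE_def)
        with elim(1) obtain k where k: "AE a in lborel. a \<in> U \<longrightarrow> r (join i a w) = k" by blast
        show ?thesis unfolding vec_lambda_fun_upd
          using k
        proof eventually_elim
          case (elim a)
          from k show ?case by eventually_elim (use elim in auto)
        qed
      qed auto
    qed
  qed (use pos in \<open>auto simp: U\<close>)
  then obtain k where k: "AE w in PiM UNIV (\<lambda>_. lborel). (\<forall>j\<in>UNIV. w j \<in> U) \<longrightarrow> r (\<chi> j. w j) = k"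
    by blast
  have [measurable]: "(\<lambda>u :: real ^ 'n. u $ j) \<in> borel_measurable borel" for j
    by (intro borel_measurable_continuous_onI continuous_intros)
  have "Measurable.pred borel (\<lambda>u :: real ^ 'n. (\<forall>j. u $ j \<in> U) \<longrightarrow> r u = k)"
    by measurable
  from AE_lborel_vec[OF this] k have "AE u in lborel. (\<forall>j. u $ j \<in> U) \<longrightarrow> r u = k"
    by simp
  then show ?thesis by (auto simp: profiles_def)
qed

lemma sets_profiles:
  assumes [measurable]: "U \<in> sets borel"
  shows "(profiles U :: (real ^ 'n::finite) set) \<in> sets borel"
proof -
  have [measurable]: "(\<lambda>u :: real ^ 'n. u $ j) \<in> borel_measurable borel" for j
    by (intro borel_measurable_continuous_onI continuous_intros)
  show ?thesis unfolding profiles_def by measurable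
qed

lemma emeasure_ne_0_if_interior:
  fixes A :: "'a::euclidean_space set"
  assumes "A \<in> sets borel" "interior A \<noteq> {}"
  shows "emeasure lborel A \<noteq> 0"
proof
  assume "emeasure lborel A = 0"
  then have "emeasure lborel (interior A) = 0"
    using emeasure_mono[of "interior A" A lborel] assms(1) interior_subset by auto
  then have "interior A \<in> null_sets lborel"
    by auto
  then show False
    using assms(2) open_not_negligible[of "interior A"] by (auto simp: negligible_iff_null_sets null_sets_completionI)
qed

section \<open>Gibbs densities and compatible laws\<close>

text \<open>With a reference action \<open>z\<close>, the factor is the exponential of
  \<open>(H i - P) / c\<close> at \<open>z\<close>. It may depend on \<open>w\<close> but not on
  \<open>a\<close>, so it cancels in conditional densities.\<close>

lemma exact_potential_imp_exp_proportional:
  assumes pot: "exact_potential H U P" and w: "w \<in> opponent_profiles U i"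
  shows "\<exists>K>0. \<forall>a\<in>U. exp (H i (join i a w) / c) = K * exp (P (join i a w) / c)"
proof (cases "U = {}")
  case True
  then show ?thesis by (intro exI[of _ 1]) auto
next
  case False
  then obtain z where z: "z \<in> U" by blast
  have "exp (H i (join i a w) / c) = exp ((H i (join i z w) - P (join i z w)) / c) * exp (P (join i a w) / c)"
    if "a \<in> U" for a
  proof -
    have "H i (join i a w) = H i (join i z w) - P (join i z w) + P (join i a w)"
      using pot w that z unfolding exact_potential_def by (smt (verit))
    then show ?thesis by (simp add: add_divide_distrib flip: exp_add)
  qed
  then show ?thesis by (intro exI[of _ "exp ((H i (join i z w) - P (join i z w)) / c)"]) auto
qed

lemma AE_set_integrable_join:
  fixes f :: "real ^ 'n::finite \<Rightarrow> real"
  assumes "set_integrable lborel (profiles U) f"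
  shows "AE w in PiM (UNIV - {i}) (\<lambda>_. lborel). w \<in> opponent_profiles U i \<longrightarrow>
    set_integrable lborel U (\<lambda>a. f (join i a w))"
  using AE_integrable_join[OF assms[unfolded set_integrable_def], of i]
proof eventually_elim
  case (elim w)
  show ?case
  proof
    assume "w \<in> opponent_profiles U i"
    then have "indicator (profiles U) (join i a w) = (indicator U a :: real)" for a
      by (auto simp: profiles_def join_def opponent_profiles_def indicator_def split: if_splits)
    with elim show "set_integrable lborel U (\<lambda>a. f (join i a w))"
      by (simp add: set_integrable_def)
  qed
qed

lemma set_lebesgue_integral_exp_pos:
  fixes f :: "'a::euclidean_space \<Rightarrow> real"
  assumes A: "A \<in> sets borel" "emeasure lborel A \<noteq> 0"
    and f: "set_integrable lborel A (\<lambda>x. exp (f x))"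
  shows "0 < set_lebesgue_integral lborel A (\<lambda>x. exp (f x))"
proof -
  have "0 \<le> set_lebesgue_integral lborel A (\<lambda>x. exp (f x))"
    unfolding set_lebesgue_integral_def by (rule integral_nonneg_AE) simp
  moreover have "set_lebesgue_integral lborel A (\<lambda>x. exp (f x)) \<noteq> 0"
  proof
    assume "set_lebesgue_integral lborel A (\<lambda>x. exp (f x)) = 0"
    then have "AE x in lborel. indicator A x *\<^sub>R exp (f x) = 0"
      using f unfolding set_integrable_def set_lebesgue_integral_def
      by (subst (asm) integral_nonneg_eq_0_iff_AE) auto
    from AE_ex_in_set[OF this, of A] A show False by auto
  qed
  ultimately show ?thesis by simp
qed

text \<open>In a full conditional of the Gibbs density the constant \<open>Z\<close> cancels, and in
  the response the factor \<open>K\<close> does. Fubini makes the weight integrable on almost every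
  line, so the response is defined there.\<close>

lemma gibbs_density_compatible:
  fixes H :: "'n::finite \<Rightarrow> real ^ 'n \<Rightarrow> real"
  assumes U: "U \<in> sets borel" and pos: "emeasure lborel (profiles U :: (real ^ 'n) set) \<noteq> 0"
    and \<gamma>: "\<And>i. \<gamma> i = c" and pot: "exact_potential H U P"
    and int: "set_integrable lborel (profiles U) (\<lambda>u. exp (P u / c))"
  shows "compatible_joint_law H \<gamma> U (gibbs_density U P c)"
proof -
  define Z where "Z = set_lebesgue_integral lborel (profiles U) (\<lambda>u. exp (P u / c))"
  have Z: "0 < Z"
    unfolding Z_def by (rule set_lebesgue_integral_exp_pos[OF sets_profiles[OF U] pos int])
  have gibbs: "gibbs_density U P c u = exp (P u / c) / Z" for u
    by (simp add: gibbs_density_def Z_def)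
  have "positive_density U (gibbs_density U P c)"
    using Z int unfolding positive_density_def gibbs
    by (simp add: set_integral_divide_zero flip: Z_def)
  moreover have "AE w in PiM (UNIV - {i}) (\<lambda>_. lborel). w \<in> opponent_profiles U i \<longrightarrow>
      response_defined H \<gamma> U i w \<and>
      (AE a in lborel. a \<in> U \<longrightarrow> full_conditional U (gibbs_density U P c) i a w = conditional_response H \<gamma> U i a w)" for i
    using AE_set_integrable_join[OF int, of i]
  proof eventually_elim
    case (elim w)
    show ?case
    proof
      assume w: "w \<in> opponent_profiles U i"
      with elim have int_w: "set_integrable lborel U (\<lambda>a. exp (P (join i a w) / c))" by blast
      obtain K where K: "0 < K" "\<And>a. a \<in> U \<Longrightarrow> exp (H i (join i a w) / c) = K * exp (P (join i a w) / c)"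
        using exact_potential_imp_exp_proportional[OF pot w] by blast
      \<comment> \<open>Proportionality is known only for actions in \<open>U\<close>; the indicator
        carries it to whole-line integrands.\<close>
      have eq: "indicator U a *\<^sub>R exp (H i (join i a w) / c) = indicator U a *\<^sub>R (K * exp (P (join i a w) / c))" for a
        using K(2) by (simp add: indicator_def)
      have "response_defined H \<gamma> U i w"
        using int_w unfolding response_defined_def \<gamma> set_integrable_def eq
        unfolding set_integrable_def[symmetric] by simp
      moreover have "set_lebesgue_integral lborel U (\<lambda>a. exp (H i (join i a w) / c)) =
          K * set_lebesgue_integral lborel U (\<lambda>a. exp (P (join i a w) / c))"
        unfolding set_lebesgue_integral_def eq unfolding set_lebesgue_integral_def[symmetric] by simp
      then have "full_conditional U (gibbs_density U P c) i a w = conditional_response H \<gamma> U i a w" if "a \<in> U" for a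
        using K Z that unfolding full_conditional_def conditional_response_def gibbs \<gamma>
        by (simp add: set_integral_divide_zero)
      ultimately show "response_defined H \<gamma> U i w \<and>
        (AE a in lborel. a \<in> U \<longrightarrow> full_conditional U (gibbs_density U P c) i a w = conditional_response H \<gamma> U i a w)"
        by simp
    qed
  qed
  ultimately show ?thesis by (simp add: compatible_joint_law_def)
qed

text \<open>On almost every coordinate line both \<open>\<psi>\<close> and the Gibbs weight are
  proportional to the response, so their quotient \<open>r\<close> is constant there and hence
  almost everywhere on \<open>profiles U\<close>. Normalization of \<open>\<psi>\<close> then
  determines the constant.\<close>

lemma compatible_joint_law_unique:
  fixes H :: "'n::finite \<Rightarrow> real ^ 'n \<Rightarrow> real"
  assumes U: "U \<in> sets borel" and pos: "emeasure lborel U \<noteq> 0"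
    and \<gamma>: "\<And>i. \<gamma> i = c" and pot: "exact_potential H U P"
    and P: "P \<in> borel_measurable (restrict_space borel (profiles U))"
    and \<psi>: "compatible_joint_law H \<gamma> U \<psi>"
  shows "set_integrable lborel (profiles U) (\<lambda>u. exp (P u / c)) \<and>
    (AE u in lborel. u \<in> profiles U \<longrightarrow> \<psi> u = gibbs_density U P c u)"
proof -
  have dens: "positive_density U \<psi>" and cond: "AE w in PiM (UNIV - {i}) (\<lambda>_. lborel). w \<in> opponent_profiles U i \<longrightarrow>
      response_defined H \<gamma> U i w \<and>
      (AE a in lborel. a \<in> U \<longrightarrow> full_conditional U \<psi> i a w = conditional_response H \<gamma> U i a w)" for i
    using \<psi> by (auto simp: compatible_joint_law_def)
  note [measurable] = sets_profiles[OF U]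
  have \<psi>_pos: "0 < \<psi> u" if "u \<in> profiles U" for u
    using dens that by (simp add: positive_density_def)
  have \<psi>_int: "set_integrable lborel (profiles U) \<psi>" "set_lebesgue_integral lborel (profiles U) \<psi> = 1"
    using dens by (auto simp: positive_density_def)
  have [measurable]: "(\<lambda>u. indicator (profiles U) u *\<^sub>R \<psi> u) \<in> borel_measurable borel"
    using \<psi>_int(1) by (auto simp: set_integrable_def)
  have P'[measurable]: "(\<lambda>u. indicator (profiles U) u *\<^sub>R P u) \<in> borel_measurable borel"
    using P by (subst (asm) borel_measurable_restrict_space_iff) auto
  \<comment> \<open>Cutting off both functions by indicators makes the quotient Borel on the whole
    space, whatever \<open>\<psi>\<close> and \<open>P\<close> are outside
    \<open>profiles U\<close>.\<close>
  define r where "r u = (indicator (profiles U) u *\<^sub>R \<psi> u) / exp ((indicator (profiles U) u *\<^sub>R P u) / c)" for u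
  have r: "r \<in> borel_measurable borel"
    unfolding r_def by measurable
  have "AE w in PiM (UNIV - {i}) (\<lambda>_. lborel). w \<in> opponent_profiles U i \<longrightarrow>
      (\<exists>k. AE a in lborel. a \<in> U \<longrightarrow> r (join i a w) = k)" for i
    using cond[of i]
  proof eventually_elim
    case (elim w)
    show ?case
    proof
      assume w: "w \<in> opponent_profiles U i"
      obtain K where K: "0 < K" "\<And>a. a \<in> U \<Longrightarrow> exp (H i (join i a w) / c) = K * exp (P (join i a w) / c)"
        using exact_potential_imp_exp_proportional[OF pot w] by blast
      define E where "E = set_lebesgue_integral lborel U (\<lambda>a. exp (H i (join i a w) / c))"
      define I where "I = set_lebesgue_integral lborel U (\<lambda>a. \<psi> (join i a w))"
      have E: "0 < E"
        unfolding E_def using elim w U pos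
        by (intro set_lebesgue_integral_exp_pos) (auto simp: response_defined_def \<gamma>)
      have "AE a in lborel. a \<in> U \<longrightarrow> full_conditional U \<psi> i a w = conditional_response H \<gamma> U i a w"
        using elim w by blast
      then have "AE a in lborel. a \<in> U \<longrightarrow> r (join i a w) = I * K / E"
      proof eventually_elim
        case (elim a)
        show ?case
        proof
          assume a: "a \<in> U"
          with elim have "\<psi> (join i a w) / I = K * exp (P (join i a w) / c) / E"
            by (simp add: full_conditional_def conditional_response_def \<gamma> I_def E_def K(2))
          \<comment> \<open>Division by zero gives 0, so \<open>I = 0\<close> would make the left
            side vanish while the right side is positive.\<close>
          moreover from this have "I \<noteq> 0" using E K(1) by auto
          ultimately have "\<psi> (join i a w) = I * K / E * exp (P (join i a w) / c)"
            using E by (simp add: field_simps)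
          with join_in_profiles[OF a w] show "r (join i a w) = I * K / E"
            by (simp add: r_def)
        qed
      qed
      then show "\<exists>k. AE a in lborel. a \<in> U \<longrightarrow> r (join i a w) = k" by blast
    qed
  qed
  from AE_constant_on_profiles[OF U pos r this] obtain k
    where k: "AE u in lborel. u \<in> profiles U \<longrightarrow> r u = k" by blast
  have \<psi>_eq: "AE u in lborel. u \<in> profiles U \<longrightarrow> \<psi> u = k * exp (P u / c)"
    using k by eventually_elim (auto simp: r_def field_simps)
  have "k \<noteq> 0"
  proof
    assume "k = 0"
    with \<psi>_eq have "AE u in lborel. indicator (profiles U) u *\<^sub>R \<psi> u = 0"
      by (auto elim: eventually_mono)
    then have "set_lebesgue_integral lborel (profiles U) \<psi> = 0"
      unfolding set_lebesgue_integral_def by (rule integral_eq_zero_AE)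
    with \<psi>_int(2) show False by simp
  qed
  have "indicator (profiles U) u *\<^sub>R exp (P u / c) =
      indicator (profiles U) u *\<^sub>R exp ((indicator (profiles U) u *\<^sub>R P u) / c)" for u
    by (simp add: indicator_def)
  moreover have "(\<lambda>u. indicator (profiles U) u *\<^sub>R exp ((indicator (profiles U) u *\<^sub>R P u) / c)) \<in> borel_measurable borel"
    by measurable
  ultimately have meas[measurable]: "(\<lambda>u. indicator (profiles U) u *\<^sub>R exp (P u / c)) \<in> borel_measurable borel"
    by (simp only:)
  have meas': "(\<lambda>u. indicator (profiles U) u *\<^sub>R \<psi> u / k) \<in> borel_measurable borel"
    by measurable
  have AE_eq: "AE u in lborel. indicator (profiles U) u *\<^sub>R \<psi> u / k = indicator (profiles U) u *\<^sub>R exp (P u / c)"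
    using \<psi>_eq by eventually_elim (use \<open>k \<noteq> 0\<close> in \<open>auto simp: indicator_def\<close>)
  \<comment> \<open>The Gibbs weight agrees almost everywhere with \<open>\<psi> / k\<close>, so it
    inherits integrability from \<open>\<psi>\<close>; its integral \<open>1 / k\<close> shows that
    \<open>k\<close> is the Gibbs normalization.\<close>
  have "integrable lborel (\<lambda>u. indicator (profiles U) u *\<^sub>R \<psi> u / k)"
    using \<psi>_int(1) unfolding set_integrable_def by (rule integrable_divide_zero)
  then have int: "set_integrable lborel (profiles U) (\<lambda>u. exp (P u / c))"
    unfolding set_integrable_def by (rule integrable_cong_AE_imp) (use AE_eq meas in \<open>auto elim: eventually_mono\<close>)
  have "set_lebesgue_integral lborel (profiles U) (\<lambda>u. exp (P u / c)) =
      (\<integral>u. indicator (profiles U) u *\<^sub>R \<psi> u / k \<partial>lborel)"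
    unfolding set_lebesgue_integral_def by (rule integral_cong_AE) (use AE_eq meas meas' in \<open>auto elim: eventually_mono\<close>)
  also have "\<dots> = 1 / k"
    using \<psi>_int(2) by (simp add: set_lebesgue_integral_def)
  finally have "gibbs_density U P c u = k * exp (P u / c)" for u
    by (simp add: gibbs_density_def)
  with int \<psi>_eq show ?thesis by simp
qed

section \<open>Measurability of local Hamiltonians and potentials\<close>

text \<open>The derivative is the pointwise limit of difference quotients with steps
  \<open>1 / (n + 1)\<close>, and each quotient evaluates \<open>V\<close> at only two fixed
  points.\<close>

lemma borel_measurable_pd:
  fixes V :: "'w \<Rightarrow> real ^ 'n::finite \<Rightarrow> real"
  assumes V[measurable]: "\<And>y. (\<lambda>\<omega>. V \<omega> y) \<in> borel_measurable M"
    and diff: "\<And>\<omega>. \<omega> \<in> space M \<Longrightarrow> V \<omega> differentiable (at y)"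
  shows "(\<lambda>\<omega>. pd k (V \<omega>) y) \<in> borel_measurable M"
proof (rule borel_measurable_LIMSEQ_real)
  let ?h = "\<lambda>n. inverse (real (Suc n))"
  fix \<omega> assume "\<omega> \<in> space M"
  then have "V \<omega> differentiable (at (y + 0 *\<^sub>R axis k 1))"
    using diff by simp
  from has_real_derivative_pd[OF this]
  have "((\<lambda>h. (V \<omega> (y + h *\<^sub>R axis k 1) - V \<omega> y) / h) \<longlongrightarrow> pd k (V \<omega>) y) (at 0)"
    by (simp add: DERIV_def)
  moreover have "filterlim ?h (at 0) sequentially"
    using LIMSEQ_inverse_real_of_nat by (simp add: filterlim_at)
  ultimately show "(\<lambda>n. (V \<omega> (y + ?h n *\<^sub>R axis k 1) - V \<omega> y) / ?h n) \<longlonglongrightarrow> pd k (V \<omega>) y"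
    by (rule filterlim_compose)
qed measurable

lemma measurable_vec_nth_restrict:
  "(\<lambda>u :: real ^ 'n::finite. u $ k) \<in> restrict_space borel (profiles U) \<rightarrow>\<^sub>M restrict_space borel U"
proof (rule measurable_restrict_space2)
  have "(\<lambda>u :: real ^ 'n. u $ k) \<in> borel_measurable borel"
    by (intro borel_measurable_continuous_onI continuous_intros)
  then show "(\<lambda>u :: real ^ 'n. u $ k) \<in> borel_measurable (restrict_space borel (profiles U))"
    by (rule measurable_restrict_space1)
qed (auto simp: space_restrict_space profiles_def)

lemma measurable_others:
  "others i \<in> restrict_space borel (profiles U :: (real ^ 'n::finite) set) \<rightarrow>\<^sub>M
    PiM (UNIV - {i}) (\<lambda>_. restrict_space borel U)"
  unfolding others_def[abs_def] by (rule measurable_restrict) (rule measurable_vec_nth_restrict)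

lemma measurable_mix:
  fixes u0 :: "real ^ 'n::finite"
  assumes "u0 \<in> profiles U"
  shows "mix S u0 \<in> restrict_space borel (profiles U) \<rightarrow>\<^sub>M restrict_space borel (profiles U)"
proof (rule measurable_restrict_space2)
  have "continuous_on UNIV (\<lambda>u :: real ^ 'n. if k \<in> S then u $ k else u0 $ k)" for k
    by (cases "k \<in> S") (auto intro!: continuous_intros)
  then have "mix S u0 \<in> borel_measurable borel"
    unfolding mix_def[abs_def] by (intro borel_measurable_continuous_onI continuous_intros)
  then show "mix S u0 \<in> borel_measurable (restrict_space borel (profiles U))"
    by (rule measurable_restrict_space1)
qed (use assms in \<open>auto simp: space_restrict_space mix_in_profiles\<close>)

text \<open>Along the path \<open>mix S u0 u\<close> each increment of \<open>P\<close> equals an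
  increment of some \<open>H i\<close>, starting from the constant \<open>P u0\<close>. Borel
  measurability of \<open>P\<close> is thus a consequence of being a potential.\<close>

lemma borel_measurable_exact_potential:
  fixes H :: "'n::finite \<Rightarrow> real ^ 'n \<Rightarrow> real"
  assumes pot: "exact_potential H U P"
    and H: "\<And>i. H i \<in> borel_measurable (restrict_space borel (profiles U))"
    and ne: "profiles U \<noteq> ({} :: (real ^ 'n) set)"
  shows "P \<in> borel_measurable (restrict_space borel (profiles U))"
proof -
  let ?B = "restrict_space borel (profiles U) :: (real ^ 'n) measure"
  obtain u0 :: "real ^ 'n" where u0: "u0 \<in> profiles U" using ne by blast
  have "(\<lambda>u. P (mix S u0 u)) \<in> borel_measurable ?B" if "finite S" for S
    using that
  proof induction
    case (insert i S)
    have "P (mix (insert i S) u0 u) = P (mix S u0 u) + (H i (mix (insert i S) u0 u) - H i (mix S u0 u))"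
      if u: "u \<in> space ?B" for u
    proof -
      have "u \<in> profiles U" using u by (simp add: space_restrict_space)
      then have "mix S u0 u \<in> profiles U" "u $ i \<in> U"
        using u0 by (auto simp: mix_in_profiles) (simp add: profiles_def)
      from exact_potentialD[OF pot this, of i] show ?thesis
        unfolding mix_insert[OF insert.hyps(2)] by simp
    qed
    moreover have "(\<lambda>u. P (mix S u0 u) + (H i (mix (insert i S) u0 u) - H i (mix S u0 u))) \<in> borel_measurable ?B"
      by (intro borel_measurable_add borel_measurable_diff insert.IH
          measurable_compose[OF measurable_mix[OF u0] H])
    ultimately show ?case by (simp cong: measurable_cong)
  qed simp
  from this[of UNIV] show ?thesis by simp
qed

text \<open>The profile \<open>u\<close> enters the derivatives of \<open>v\<close> only as a
  parameter, through \<open>others i u\<close>, so \<open>borel_measurable_pd\<close> applies. The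
  Hamiltonian uses only diagonal entries of the Hessian.\<close>

lemma borel_measurable_local_hamiltonian:
  fixes b \<sigma> :: "'n::finite \<Rightarrow> real \<Rightarrow> real ^ 'n \<Rightarrow> real ^ 'n \<Rightarrow> real"
  assumes t: "t \<in> {0..T}"
    and b: "\<And>k. (\<lambda>(s, y, u). b k s y u) \<in> borel_measurable (restrict_space borel ({0..T} \<times> UNIV \<times> profiles U))"
    and \<sigma>: "\<And>k. (\<lambda>(s, y, u). \<sigma> k s y u) \<in> borel_measurable (restrict_space borel ({0..T} \<times> UNIV \<times> profiles U))"
    and f: "(\<lambda>(s, y, a). f i s y a) \<in> borel_measurable (restrict_space borel ({0..T} \<times> UNIV \<times> U))"
    and v: "\<And>y. v i t y \<in> borel_measurable (PiM (UNIV - {i}) (\<lambda>_. restrict_space borel U))"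
    and C2: "\<And>w. w \<in> opponent_profiles U i \<Longrightarrow> C2_on UNIV (\<lambda>y. v i t y w)"
  shows "local_hamiltonian b \<sigma> f v i t x \<in> borel_measurable (restrict_space borel (profiles U))"
proof -
  let ?B = "restrict_space borel (profiles U) :: (real ^ 'n) measure"
  let ?V = "\<lambda>u y. v i t y (others i u)"
  have V: "(\<lambda>u. ?V u y) \<in> borel_measurable ?B" for y
    using measurable_compose[OF measurable_others v] .
  have C2': "C2_on UNIV (?V u)" if "u \<in> space ?B" for u
    using that by (intro C2 others_in_opponent_profiles) (simp add: space_restrict_space)
  \<comment> \<open>Needed at every \<open>y\<close>, because the second derivative is a limit of
    quotients of first derivatives at shifted points.\<close>
  have pd1: "(\<lambda>u. pd k (?V u) y) \<in> borel_measurable ?B" for k y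
    by (rule borel_measurable_pd[OF V]) (use C2' in \<open>simp add: C2_on_def C1_on_def\<close>)
  have pd2: "(\<lambda>u. pd k (pd k (?V u)) y) \<in> borel_measurable ?B" for k y
    by (rule borel_measurable_pd[OF pd1]) (use C2' in \<open>simp add: C2_on_def C1_on_def\<close>)
  have "(\<lambda>u. u) \<in> borel_measurable ?B"
    by (rule measurable_restrict_space1) simp
  then have tx: "(\<lambda>u. (t, x, u)) \<in> ?B \<rightarrow>\<^sub>M restrict_space borel ({0..T} \<times> UNIV \<times> profiles U)"
    using t by (intro measurable_restrict_space2 borel_measurable_Pair measurable_const) (auto simp: space_restrict_space)
  have txa: "(\<lambda>u. (t, x, u $ i)) \<in> ?B \<rightarrow>\<^sub>M restrict_space borel ({0..T} \<times> UNIV \<times> U)"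
  proof -
    have "(\<lambda>u. u $ i) \<in> borel_measurable ?B"
      using measurable_vec_nth_restrict[of i U] by (auto simp: measurable_restrict_space2_iff)
    then show ?thesis
      using t by (intro measurable_restrict_space2 borel_measurable_Pair measurable_const)
        (auto simp: space_restrict_space profiles_def)
  qed
  have [measurable]: "(\<lambda>u. b k t x u) \<in> borel_measurable ?B" "(\<lambda>u. \<sigma> k t x u) \<in> borel_measurable ?B"
    "(\<lambda>u. f i t x (u $ i)) \<in> borel_measurable ?B" for k
    using measurable_compose[OF tx b[of k]] measurable_compose[OF tx \<sigma>[of k]] measurable_compose[OF txa f]
    by simp_all
  note [measurable] = pd1 pd2
  show ?thesis
    unfolding local_hamiltonian_def[abs_def] hamiltonian_def grad_def hessian_def vec_lambda_beta
    by measurable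
qed

text \<open>A potential is determined by its gradient up to an additive constant, and a density up
  to null sets; the identities with \<open>P / c\<close> and with the Gibbs density are read
  accordingly. A compatible law exists exactly if the Gibbs weight is integrable, as the last two
  clauses show together.\<close>

theorem proposition12:
  fixes b \<sigma> :: "'n::finite \<Rightarrow> real \<Rightarrow> real ^ 'n \<Rightarrow> real ^ 'n \<Rightarrow> real"
    and f :: "'n \<Rightarrow> real \<Rightarrow> real ^ 'n \<Rightarrow> real \<Rightarrow> real"
    and g :: "'n \<Rightarrow> real ^ 'n \<Rightarrow> real"
    and \<beta> \<gamma> :: "'n \<Rightarrow> real"
    and T :: real
    and U :: "real set"
    and v :: "'n \<Rightarrow> real \<Rightarrow> real ^ 'n \<Rightarrow> ('n \<Rightarrow> real) \<Rightarrow> real"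
    and t :: real and x :: "real ^ 'n"
  defines "D \<equiv> interior (profiles U :: (real ^ 'n) set)"
    and "H \<equiv> \<lambda>i. local_hamiltonian b \<sigma> f v i t x"
  assumes "0 < T"
    and "\<And>i. 0 \<le> \<beta> i" and "\<And>i. 0 < \<gamma> i"
    and "U \<in> sets borel"
    and "D \<noteq> {}" and "connected D" and "simply_connected D"
    and "\<And>k. (\<lambda>(s, y, u). b k s y u) \<in> borel_measurable (restrict_space borel ({0..T} \<times> UNIV \<times> profiles U))"
    and "\<And>k. (\<lambda>(s, y, u). \<sigma> k s y u) \<in> borel_measurable (restrict_space borel ({0..T} \<times> UNIV \<times> profiles U))"
    and "\<And>i. (\<lambda>(s, y, a). f i s y a) \<in> borel_measurable (restrict_space borel ({0..T} \<times> UNIV \<times> U))"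
    and "\<And>i w. w \<in> opponent_profiles U i \<Longrightarrow>
           classical_solution b \<sigma> f g \<beta> \<gamma> T U i w (\<lambda>s y. v i s y w)"
    and "\<And>i s y. s \<in> {0..T} \<Longrightarrow>
           v i s y \<in> borel_measurable (PiM (UNIV - {i}) (\<lambda>_. restrict_space borel U))"
    and "t \<in> {0..T}"
    and "\<And>i. C2_on D (H i)"
  shows "((\<forall>u\<in>D. \<forall>i j. i \<noteq> j \<longrightarrow>
             1 / \<gamma> i * pd j (pd i (H i)) u = 1 / \<gamma> j * pd i (pd j (H j)) u) \<longleftrightarrow>
          (\<exists>\<Phi>. response_potential H \<gamma> D \<Phi>)) \<and>
         (\<forall>c P. (\<forall>i. \<gamma> i = c) \<and> exact_potential H U P \<longrightarrow>
            response_potential H \<gamma> D (\<lambda>u. P u / c) \<and>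
            (\<forall>\<Phi>. response_potential H \<gamma> D \<Phi> \<longrightarrow> (\<exists>d. \<forall>u\<in>D. \<Phi> u = P u / c + d)) \<and>
            (set_integrable lborel (profiles U) (\<lambda>u. exp (P u / c)) \<longrightarrow>
               compatible_joint_law H \<gamma> U (gibbs_density U P c)) \<and>
            (\<forall>\<psi>. compatible_joint_law H \<gamma> U \<psi> \<longrightarrow>
               set_integrable lborel (profiles U) (\<lambda>u. exp (P u / c)) \<and>
               (AE u in lborel. u \<in> profiles U \<longrightarrow> \<psi> u = gibbs_density U P c u)))"
proof -
  note a = assms(3-)
  have D: "D = profiles (interior U)"
    unfolding D_def by (rule interior_profiles)
  have U: "U \<in> sets borel" and ne: "D \<noteq> {}" and tT: "t \<in> {0..T}" and H: "\<And>i. C2_on D (H i)"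
    and \<gamma>: "\<And>i. 0 < \<gamma> i"
    by (fact a)+
  \<comment> \<open>A connected subset of the line is an interval, so the domain is a convex box and
    integration along segments is available.\<close>
  have "connected (interior U)"
    using \<open>connected D\<close> unfolding D by (rule connected_profilesD)
  then have conv: "convex (interior U)"
    using is_interval_connected_1 is_interval_convex_1 by blast
  have D': "open D" "convex D"
    by (simp add: D_def) (simp add: D convex_profiles conv)
  have "interior U \<noteq> {}"
    using ne by (auto simp: D profiles_def)
  then have pos: "emeasure lborel U \<noteq> 0"
    using U by (intro emeasure_ne_0_if_interior)
  have pos': "emeasure lborel (profiles U :: (real ^ 'n) set) \<noteq> 0"
    using ne by (intro emeasure_ne_0_if_interior sets_profiles U) (simp add: D_def)
  have neU: "profiles U \<noteq> ({} :: (real ^ 'n) set)"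
    using ne interior_subset[of "profiles U :: (real ^ 'n) set"] by (auto simp: D_def)
  have C2: "C2_on UNIV (\<lambda>y. v i t y w)" if "w \<in> opponent_profiles U i" for i w
    using a(11)[OF that] tT by (simp add: classical_solution_def C12_def)
  have H_meas: "H i \<in> borel_measurable (restrict_space borel (profiles U))" for i
    unfolding H_def by (rule borel_measurable_local_hamiltonian[where b = b and \<sigma> = \<sigma> and f = f
          and v = v and i = i, OF tT a(8) a(9) a(10) a(12)[OF tT] C2])
  have main: "response_potential H \<gamma> D (\<lambda>u. P u / c) \<and>
      (\<forall>\<Phi>. response_potential H \<gamma> D \<Phi> \<longrightarrow> (\<exists>d. \<forall>u\<in>D. \<Phi> u = P u / c + d)) \<and>
      (set_integrable lborel (profiles U) (\<lambda>u. exp (P u / c)) \<longrightarrow>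
         compatible_joint_law H \<gamma> U (gibbs_density U P c)) \<and>
      (\<forall>\<psi>. compatible_joint_law H \<gamma> U \<psi> \<longrightarrow>
         set_integrable lborel (profiles U) (\<lambda>u. exp (P u / c)) \<and>
         (AE u in lborel. u \<in> profiles U \<longrightarrow> \<psi> u = gibbs_density U P c u))"
    if c: "\<And>i. \<gamma> i = c" and pot: "exact_potential H U P" for c P
  proof (intro conjI[OF _ conjI[OF _ conjI]] allI impI)
    have "c \<noteq> 0" using \<gamma>[of undefined] c[of undefined] by simp
    show rp: "response_potential H \<gamma> D (\<lambda>u. P u / c)"
      unfolding D by (rule exact_potential_imp_response_potential[OF pot c \<open>c \<noteq> 0\<close>])
        (use H in \<open>simp add: D C2_on_def\<close>)
    show "\<exists>d. \<forall>u\<in>D. \<Phi> u = P u / c + d" if "response_potential H \<gamma> D \<Phi>" for \<Phi>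
      using response_potential_unique[OF conv] ne that rp unfolding D by blast
    show "compatible_joint_law H \<gamma> U (gibbs_density U P c)"
      if "set_integrable lborel (profiles U) (\<lambda>u. exp (P u / c))"
      by (rule gibbs_density_compatible[OF U pos' c pot that])
    show "set_integrable lborel (profiles U) (\<lambda>u. exp (P u / c)) \<and>
        (AE u in lborel. u \<in> profiles U \<longrightarrow> \<psi> u = gibbs_density U P c u)"
      if "compatible_joint_law H \<gamma> U \<psi>" for \<psi>
      by (rule compatible_joint_law_unique[OF U pos c pot borel_measurable_exact_potential[OF pot H_meas neU] that])
  qed
  show ?thesis
  proof (rule conjI)
    show "(\<forall>u\<in>D. \<forall>i j. i \<noteq> j \<longrightarrow>
        1 / \<gamma> i * pd j (pd i (H i)) u = 1 / \<gamma> j * pd i (pd j (H j)) u) \<longleftrightarrow>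
      (\<exists>\<Phi>. response_potential H \<gamma> D \<Phi>)"
      by (rule cross_condition_iff_response_potential[OF D' ne H])
  qed (intro allI impI, elim conjE, rule main, erule spec, assumption)
qed

end
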